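(* Let $N=(G,w,\mathfrak{h})$ be a cylindric network with $n$ sources and $n$ sinks, and let $X(N)$ be its associated infinite matrix. Let $I=\{i_1<\dots<i_K\}$ and $J=\{j_1<\dots<j_K\}$ be two finite sets of integers of equal cardinality $K$, and let $\Delta_{I,J}(X(N))$ denote the minor of $X(N)$ with row set $I$ and column set $J$. Let $\Phi(I,J)$ be the set of all families $P=\{p_k\}_{k=1}^K$ of paths in $G$ such that each $p_k$ is an $(i_k,j_k)$-path and every pair of paths in $P$ is uncrossed. Then $$\Delta_{I,J}(X(N))=\sum_{P\in\Phi(I,J)}w(P).$$
   Context: Fix $n\ge1$. For $i\in\mathbb{Z}$, $\bar i\in\{1,\dots,n\}$ is the representative of $i$ modulo $n$, and $\alpha(i)=(i-\bar i)/n$. A cylindric network $N=(G,w,\mathfrak h)$ consists of: a finite acyclic oriented graph $G$ embedded in the cylinder $S^1\times[0,1]$, having $n$ sources $v_1,\dots,v_n$ on one boundary circle (the bottom) and $n$ sinks $w_1,\dots,w_n$ on the other boundary circle (the top), sources and sinks each numbered in counterclockwise order (viewed from above); a weight function $w$ assigning to each edge a nonnegative real number; and a chord $\mathfrak h$, a single arc connecting the two boundary circles, starting on the boundary arc from $v_n$ to $v_1$ and ending on the boundary arc from $w_n$ to $w_1$, chosen so that no vertex of $G$ lies on it. The weight $w(p)$ of a (directed) path $p$ is the product of the weights of its edges; for a family $P$ of paths, $w(P)=\prod_{p\in P}w(p)$. The rotor $\mathrm{rot}(p)$ of a path $p$ is the number of times $p$ crosses $\mathfrak h$ counterclockwise minus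 the number of times it crosses $\mathfrak h$ clockwise. For $i,j\in\mathbb{Z}$, an $(i,j)$-path is a path in $G$ from the source $v_{\bar i}$ to the sink $w_{\bar j}$ with rotor equal to $\alpha(j)-\alpha(i)$. The matrix $X(N)=(x_{i,j})_{i,j\in\mathbb{Z}}$ has $x_{i,j}$ equal to the sum of $w(p)$ over all $(i,j)$-paths $p$. Let $p$ be an $(i,j)$-path and $q$ an $(i',j')$-path, with a common point (vertex of $G$) $c$. Let $\tilde p$ be the path following $p$ until $c$ and $q$ afterwards, and $\tilde q$ the path following $q$ until $c$ and $p$ afterwards. The point $c$ is a proper crossing of $p$ and $q$ if $\tilde p$ is an $(i,j')$-path (equivalently, $\tilde q$ is an $(i',j)$-path). Two paths having no proper crossing are called uncrossed. *)

theory Defs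
  imports
    "Jordan_Normal_Form.Determinant"
    "Graph_Theory.Graph_Theory"
    "HOL-Analysis.Analysis"
begin

type_synonym cylpoint = "complex \<times> real"

definition cylinder :: "cylpoint set" where
  "cylinder = sphere 0 1 \<times> {0..1}"

text \<open>The universal cover is the strip; seen from above (the second coordinate pointing upwards),
  counterclockwise is the direction of increasing first coordinate.\<close>

definition strip :: "(real \<times> real) set" where
  "strip = UNIV \<times> {0..1}"

definition cyl_cover :: "real \<times> real \<Rightarrow> cylpoint" where
  "cyl_cover x = (cis (fst x), snd x)"

definition is_lift :: "(real \<Rightarrow> cylpoint) \<Rightarrow> (real \<Rightarrow> real \<times> real) \<Rightarrow> bool" where
  "is_lift g gt \<longleftrightarrow> path gt \<and> (\<forall>t\<in>{0..1}. cyl_cover (gt t) = g t)"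

definition ccw_ordered :: "nat \<Rightarrow> (nat \<Rightarrow> complex) \<Rightarrow> bool" where
  "ccw_ordered n z \<longleftrightarrow>
     (\<exists>\<theta>. (\<forall>i\<in>{1..n}. z i = cis (\<theta> i)) \<and> strict_mono_on {1..n} \<theta> \<and> \<theta> n < \<theta> 1 + 2 * pi)"

text \<open>The open counterclockwise arc from \<open>a\<close> to \<open>b\<close>; for \<open>a = b\<close> (which occurs for networks
  with one source) it is the circle without \<open>a\<close>.\<close>

definition ccw_arc :: "complex \<Rightarrow> complex \<Rightarrow> complex set" where
  "ccw_arc a b = {cis t | t s u. cis s = a \<and> cis u = b \<and> s < t \<and> t < u \<and> u \<le> s + 2 * pi}"

text \<open>A lift of a chord runs from the bottom to the top of the strip and separates its left end
  (the clockwise side of the chord) from its right end (the counterclockwise side).\<close>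

definition cw_side :: "(real \<Rightarrow> real \<times> real) \<Rightarrow> (real \<times> real) set" where
  "cw_side ht =
     {x. \<exists>M. \<forall>y\<in>strip. fst y < M \<longrightarrow> connected_component (strip - path_image ht) x y}"

definition ccw_side :: "(real \<Rightarrow> real \<times> real) \<Rightarrow> (real \<times> real) set" where
  "ccw_side ht =
     {x. \<exists>M. \<forall>y\<in>strip. fst y > M \<longrightarrow> connected_component (strip - path_image ht) x y}"

text \<open>The curve \<open>g\<close> crosses the chord \<open>h\<close> at time \<open>t\<close> if it is on the chord at that time and
  on different sides of it just before and just after. Merely touching the chord is no crossing.\<close>

definition crosses_ccw_at :: "(real \<Rightarrow> cylpoint) \<Rightarrow> (real \<Rightarrow> cylpoint) \<Rightarrow> real \<Rightarrow> bool" where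
  "crosses_ccw_at h g t \<longleftrightarrow>
     (\<exists>gt ht. is_lift g gt \<and> is_lift h ht \<and> gt t \<in> path_image ht \<and>
        (\<forall>\<^sub>F s in at_left t. gt s \<in> cw_side ht) \<and> (\<forall>\<^sub>F s in at_right t. gt s \<in> ccw_side ht))"

definition crosses_cw_at :: "(real \<Rightarrow> cylpoint) \<Rightarrow> (real \<Rightarrow> cylpoint) \<Rightarrow> real \<Rightarrow> bool" where
  "crosses_cw_at h g t \<longleftrightarrow>
     (\<exists>gt ht. is_lift g gt \<and> is_lift h ht \<and> gt t \<in> path_image ht \<and>
        (\<forall>\<^sub>F s in at_left t. gt s \<in> ccw_side ht) \<and> (\<forall>\<^sub>F s in at_right t. gt s \<in> cw_side ht))"

definition curve_rotor :: "(real \<Rightarrow> cylpoint) \<Rightarrow> (real \<Rightarrow> cylpoint) \<Rightarrow> int" where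
  "curve_rotor h g =
     int (card {t\<in>{0<..<1}. crosses_ccw_at h g t}) - int (card {t\<in>{0<..<1}. crosses_cw_at h g t})"

text \<open>Parallel edges are allowed. The functions \<open>source\<close> and \<open>sink\<close> are only relevant on
  \<open>{1..n}\<close>.\<close>

record ('v, 'e) cyl_network =
  graph :: "('v, 'e) pre_digraph"
  position :: "'v \<Rightarrow> cylpoint"
  curve :: "'e \<Rightarrow> real \<Rightarrow> cylpoint"
  edge_weight :: "'e \<Rightarrow> real"
  source :: "nat \<Rightarrow> 'v"
  sink :: "nat \<Rightarrow> 'v"
  chord :: "real \<Rightarrow> cylpoint"

definition embedded_in_cylinder ::
    "('v, 'e) pre_digraph \<Rightarrow> ('v \<Rightarrow> cylpoint) \<Rightarrow> ('e \<Rightarrow> real \<Rightarrow> cylpoint) \<Rightarrow> bool" where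
  "embedded_in_cylinder G pos cv \<longleftrightarrow>
     inj_on pos (verts G) \<and> pos ` verts G \<subseteq> cylinder \<and>
     (\<forall>e\<in>arcs G. arc (cv e) \<and> path_image (cv e) \<subseteq> cylinder \<and>
        pathstart (cv e) = pos (tail G e) \<and> pathfinish (cv e) = pos (head G e) \<and>
        path_image (cv e) \<inter> pos ` verts G = {pos (tail G e), pos (head G e)}) \<and>
     (\<forall>e\<in>arcs G. \<forall>f\<in>arcs G. e \<noteq> f \<longrightarrow>
        path_image (cv e) \<inter> path_image (cv f) \<subseteq> pos ` verts G)"

text \<open>The finiteness condition makes the number of crossings of a path with the chord
  meaningful.\<close>

locale cylindric_network =
  fixes n :: nat and N :: "('v, 'e) cyl_network"
  assumes n_pos: "n \<ge> 1"
    and fin_digraph_graph: "fin_digraph (graph N)"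
    and acyclic_graph: "acyclic (arcs_ends (graph N))"
    and embedded: "embedded_in_cylinder (graph N) (position N) (curve N)"
    and weight_nonneg: "e \<in> arcs (graph N) \<Longrightarrow> edge_weight N e \<ge> 0"
    and source_vert: "i \<in> {1..n} \<Longrightarrow> source N i \<in> verts (graph N)"
    and source_in_arcs: "i \<in> {1..n} \<Longrightarrow> in_arcs (graph N) (source N i) = {}"
    and source_bottom: "i \<in> {1..n} \<Longrightarrow> snd (position N (source N i)) = 0"
    and source_ccw: "ccw_ordered n (\<lambda>i. fst (position N (source N i)))"
    and sink_vert: "i \<in> {1..n} \<Longrightarrow> sink N i \<in> verts (graph N)"
    and sink_out_arcs: "i \<in> {1..n} \<Longrightarrow> out_arcs (graph N) (sink N i) = {}"
    and sink_top: "i \<in> {1..n} \<Longrightarrow> snd (position N (sink N i)) = 1"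
    and sink_ccw: "ccw_ordered n (\<lambda>i. fst (position N (sink N i)))"
    and chord_arc: "arc (chord N)" "path_image (chord N) \<subseteq> cylinder"
    and chord_start: "snd (pathstart (chord N)) = 0"
      "fst (pathstart (chord N)) \<in>
         ccw_arc (fst (position N (source N n))) (fst (position N (source N 1)))"
    and chord_finish: "snd (pathfinish (chord N)) = 1"
      "fst (pathfinish (chord N)) \<in>
         ccw_arc (fst (position N (sink N n))) (fst (position N (sink N 1)))"
    and chord_interior: "t \<in> {0<..<1} \<Longrightarrow> snd (chord N t) \<in> {0<..<1}"
    and chord_avoids_verts: "v \<in> verts (graph N) \<Longrightarrow> position N v \<notin> path_image (chord N)"
    and chord_meets_finitely:
      "e \<in> arcs (graph N) \<Longrightarrow> finite {t\<in>{0..1}. curve N e t \<in> path_image (chord N)}"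

definition path_weight :: "('v, 'e) cyl_network \<Rightarrow> 'e list \<Rightarrow> real" where
  "path_weight N p = (\<Prod>e\<leftarrow>p. edge_weight N e)"

text \<open>No vertex lies on the chord, so all crossings of a path are crossings of its edges.\<close>

definition rotor :: "('v, 'e) cyl_network \<Rightarrow> 'e list \<Rightarrow> int" where
  "rotor N p = (\<Sum>e\<leftarrow>p. curve_rotor (chord N) (curve N e))"

definition residue_rep :: "nat \<Rightarrow> int \<Rightarrow> nat" where
  "residue_rep n i = nat ((i - 1) mod int n) + 1"

definition alpha :: "nat \<Rightarrow> int \<Rightarrow> int" where
  "alpha n i = (i - int (residue_rep n i)) div int n"

definition ij_paths :: "nat \<Rightarrow> ('v, 'e) cyl_network \<Rightarrow> int \<Rightarrow> int \<Rightarrow> 'e list set" where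
  "ij_paths n N i j =
     {p. pre_digraph.apath (graph N) (source N (residue_rep n i)) p (sink N (residue_rep n j)) \<and>
         rotor N p = alpha n j - alpha n i}"

definition network_matrix :: "nat \<Rightarrow> ('v, 'e) cyl_network \<Rightarrow> int \<Rightarrow> int \<Rightarrow> real" where
  "network_matrix n N i j = (\<Sum>p\<in>ij_paths n N i j. path_weight N p)"

definition int_minor :: "int set \<Rightarrow> int set \<Rightarrow> (int \<Rightarrow> int \<Rightarrow> real) \<Rightarrow> real" where
  "int_minor I J X = Determinant.det (Matrix.mat (card I) (card J)
     (\<lambda>(k, l). X (sorted_list_of_set I ! k) (sorted_list_of_set J ! l)))"

text \<open>To be used for paths through \<open>c\<close>; if \<open>c\<close> is the last vertex of \<open>p\<close>, all of \<open>p\<close> is kept.\<close>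

definition switch_at :: "('v, 'e) pre_digraph \<Rightarrow> 'v \<Rightarrow> 'e list \<Rightarrow> 'e list \<Rightarrow> 'e list" where
  "switch_at G c p q =
     takeWhile (\<lambda>e. tail G e \<noteq> c) p @ dropWhile (\<lambda>e. tail G e \<noteq> c) q"

text \<open>Here \<open>p\<close> is an \<open>(i, j)\<close>-path and \<open>q\<close> an \<open>(i', j')\<close>-path. The index \<open>j\<close> is not needed.\<close>

definition proper_crossing ::
    "nat \<Rightarrow> ('v, 'e) cyl_network \<Rightarrow> int \<Rightarrow> 'e list \<Rightarrow> int \<Rightarrow> int \<Rightarrow> 'e list \<Rightarrow> 'v \<Rightarrow> bool" where
  "proper_crossing n N i p i' j' q c \<longleftrightarrow>
     c \<in> set (pre_digraph.awalk_verts (graph N) (source N (residue_rep n i)) p) \<and>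
     c \<in> set (pre_digraph.awalk_verts (graph N) (source N (residue_rep n i')) q) \<and>
     switch_at (graph N) c p q \<in> ij_paths n N i j'"

definition uncrossed ::
    "nat \<Rightarrow> ('v, 'e) cyl_network \<Rightarrow> int \<Rightarrow> 'e list \<Rightarrow> int \<Rightarrow> int \<Rightarrow> 'e list \<Rightarrow> bool" where
  "uncrossed n N i p i' j' q \<longleftrightarrow> \<not> (\<exists>c. proper_crossing n N i p i' j' q c)"

text \<open>The members of a family are indexed by \<open>k < card I\<close>, starting from \<open>0\<close>.\<close>

definition uncrossed_families ::
    "nat \<Rightarrow> ('v, 'e) cyl_network \<Rightarrow> int set \<Rightarrow> int set \<Rightarrow> (nat \<Rightarrow> 'e list) set" where
  "uncrossed_families n N I J =
     (let i = (!) (sorted_list_of_set I); j = (!) (sorted_list_of_set J) in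
      {P \<in> (\<Pi>\<^sub>E k\<in>{..<card I}. ij_paths n N (i k) (j k)).
         \<forall>k<card I. \<forall>l<card I. k \<noteq> l \<longrightarrow> uncrossed n N (i k) (P k) (i l) (j l) (P l)})"

definition family_weight :: "('v, 'e) cyl_network \<Rightarrow> nat \<Rightarrow> (nat \<Rightarrow> 'e list) \<Rightarrow> real" where
  "family_weight N K P = (\<Prod>k<K. path_weight N (P k))"

end

theory Submission
  imports Defs
begin

text \<open>The cylinder is covered by the strip \<open>\<real> \<times> [0,1]\<close>, and the lifts of the chord cut the strip into
pieces numbered by the integers. A lifted point off these cuts thus has a level, the number of its
piece, and a vertex of the lifted graph can be written as a pair \<open>(v, k)\<close> of a vertex and a level.
Walking along a lifted path, the level changes by the rotor of the part walked so far. Hence an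
\<open>(i, j)\<close>-path is a path of the lifted graph from \<open>(v, \<alpha> i)\<close> to \<open>(w, \<alpha> j)\<close>, where \<open>v\<close> is the
source for \<open>i\<close> and \<open>w\<close> the sink for \<open>j\<close>, and a proper crossing of two paths is a common vertex of
their lifts. The network matrix is therefore the path matrix of the acyclic lifted graph, and
uncrossed families are families of vertex-disjoint lifted paths.

So the theorem is an instance of the Lindstroem-Gessel-Viennot lemma: in the expansion of the
determinant, the terms of intersecting families cancel in pairs, by exchanging the tails of two
paths at a canonically chosen common vertex (\<open>lindstroem_gessel_viennot\<close>). What is left are disjoint
families, and among these only the identity permutation occurs, because two lifted paths whose
sources and sinks are in opposite order must meet (\<open>crossing_paths_meet\<close>). The reason is planarity:
their curves join the two boundary lines of the strip in opposite order, so they have a common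
point by the Fashoda meet theorem (\<open>strip_paths_cross\<close>), and by the embedding such a point is a
vertex or lies on an edge used by both.

The topological input that ties rotors to levels is \<open>lift_level\<close>: signed crossings with the chord
add up to the change of level. It rests on the fact that every lift of the chord splits the strip
into exactly two sides. They are different by the Fashoda theorem (\<open>sides_disjoint\<close>), and there is no
third one because an arc does not separate the plane (\<open>sides_cover\<close>).\<close>

section \<open>Disjoint path families and determinants\<close>

text \<open>Paths are label sequences of a deterministic transition system: a start state and a list of edges
determine all states passed. Parallel edges stay distinct in this way, and one edge list serves as
a path of a graph and, with a level added to the states, as a path of its covering graph.\<close>

locale transition_system =
  fixes enabled :: "'s \<Rightarrow> 'e \<Rightarrow> bool" and step :: "'s \<Rightarrow> 'e \<Rightarrow> 's"
begin

primrec run :: "'s \<Rightarrow> 'e list \<Rightarrow> 's \<Rightarrow> bool" where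
  "run s [] t \<longleftrightarrow> s = t"
| "run s (e # p) t \<longleftrightarrow> enabled s e \<and> run (step s e) p t"

definition state_at :: "'s \<Rightarrow> 'e list \<Rightarrow> nat \<Rightarrow> 's" where
  "state_at s p m = foldl step s (take m p)"

definition visited :: "'s \<Rightarrow> 'e list \<Rightarrow> 's set" where
  "visited s p = state_at s p ` {..length p}"

lemma run_append: "run s (p @ q) t \<longleftrightarrow> (\<exists>u. run s p u \<and> run u q t)"
  by (induction p arbitrary: s) auto

lemma run_foldl: "run s p t \<Longrightarrow> foldl step s p = t"
  by (induction p arbitrary: s) auto

lemma run_take: "run s p t \<Longrightarrow> run s (take m p) (state_at s p m)"
  by (metis append_take_drop_id run_append run_foldl state_at_def)

lemma run_drop: "run s p t \<Longrightarrow> run (state_at s p m) (drop m p) t"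
  by (metis append_take_drop_id run_append run_foldl state_at_def)

lemma run_splice:
  assumes "run s p t" "run s' q t'" "state_at s p m = state_at s' q m'"
  shows "run s (take m p @ drop m' q) t'"
  using run_take[OF assms(1), of m] run_drop[OF assms(2), of m'] assms(3)
  by (auto simp: run_append)

text \<open>From the common state on, the states depend only on the remaining edges, which are those of \<open>q\<close>.\<close>

lemma state_at_splice:
  assumes "m \<le> length p" "state_at s p m = state_at s' q m'"
  shows "state_at s (take m p @ drop m' q) i =
    (if i \<le> m then state_at s p i else state_at s' q (m' + (i - m)))"
proof (cases "i \<le> m")
  case False
  have "take i (take m p @ drop m' q) = take m p @ take (i - m) (drop m' q)"
    using False assms(1) by simp
  moreover have "take (m' + (i - m)) q = take m' q @ take (i - m) (drop m' q)"
    by (rule take_add)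
  ultimately show ?thesis
    using False assms(2) by (simp add: state_at_def)
qed (use assms(1) in \<open>simp add: state_at_def min_def\<close>)

lemma visited_splice:
  assumes "m \<le> length p" "m' \<le> length q" "state_at s p m = state_at s' q m'"
  shows "visited s (take m p @ drop m' q) = state_at s p ` {..m} \<union> state_at s' q ` {m'..length q}"
    (is "_ = ?R")
proof
  let ?r = "take m p @ drop m' q"
  have len: "length ?r = m + (length q - m')" using assms by simp
  show "visited s ?r \<subseteq> ?R"
  proof
    fix x assume "x \<in> visited s ?r"
    then obtain i where i: "i \<le> length ?r" "x = state_at s ?r i" by (auto simp: visited_def)
    show "x \<in> ?R"
    proof (cases "i \<le> m")
      case True
      then show ?thesis using i state_at_splice[OF assms(1,3), of i] by auto
    next
      case False
      then have "m' + (i - m) \<in> {m'..length q}" using i(1) len assms(2) by auto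
      then show ?thesis using i state_at_splice[OF assms(1,3), of i] False by auto
    qed
  qed
  show "?R \<subseteq> visited s ?r"
  proof
    fix x assume "x \<in> ?R"
    then consider i where "i \<le> m" "x = state_at s p i"
      | i where "m' < i" "i \<le> length q" "x = state_at s' q i"
      using assms(3) by (force simp: le_less)
    then show "x \<in> visited s ?r"
    proof cases
      case 1
      then have "x = state_at s ?r i" using state_at_splice[OF assms(1,3), of i] by simp
      then show ?thesis using 1 len by (auto simp: visited_def)
    next
      case (2 i)
      then have "x = state_at s ?r (m + (i - m'))" "m + (i - m') \<le> length ?r"
        using state_at_splice[OF assms(1,3), of "m + (i - m')"] len by auto
      then show ?thesis by (auto simp: visited_def)
    qed
  qed
qed

end

text \<open>The paths from \<open>a k\<close> to \<open>b l\<close> have to be simple, so that a common state of two paths determines the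
positions at which their tails are exchanged.\<close>

locale path_families = transition_system enabled step
  for enabled :: "'s \<Rightarrow> 'e \<Rightarrow> bool" and step :: "'s \<Rightarrow> 'e \<Rightarrow> 's" +
  fixes K :: nat and a b :: "nat \<Rightarrow> 's"
  assumes finite_runs: "k < K \<Longrightarrow> l < K \<Longrightarrow> finite {p. run (a k) p (b l)}"
    and run_simple: "k < K \<Longrightarrow> l < K \<Longrightarrow> run (a k) p (b l) \<Longrightarrow> inj_on (state_at (a k) p) {..length p}"
begin

definition families :: "(nat \<Rightarrow> nat) \<Rightarrow> (nat \<Rightarrow> 'e list) set" where
  "families \<sigma> = (\<Pi>\<^sub>E k\<in>{..<K}. {p. run (a k) p (b (\<sigma> k))})"

definition meets :: "(nat \<Rightarrow> 'e list) \<Rightarrow> nat \<Rightarrow> nat \<Rightarrow> nat \<Rightarrow> bool" where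
  "meets P k m l \<longleftrightarrow> k < K \<and> l < K \<and> k \<noteq> l \<and> m \<le> length (P k) \<and>
     state_at (a k) (P k) m \<in> visited (a l) (P l)"

definition disjoint_runs :: "(nat \<Rightarrow> 'e list) \<Rightarrow> bool" where
  "disjoint_runs P \<longleftrightarrow>
     (\<forall>k<K. \<forall>l<K. k \<noteq> l \<longrightarrow> visited (a k) (P k) \<inter> visited (a l) (P l) = {})"

lemma not_disjoint_iff: "\<not> disjoint_runs P \<longleftrightarrow> (\<exists>k m l. meets P k m l)"
  unfolding disjoint_runs_def meets_def visited_def by blast

text \<open>The lexicographically first triple of a path that meets another one, a position on it, and a partner
met there. Exchanging the tails at this place does not change which triple is first, and
this makes the exchange an involution.\<close>

definition first_meeting :: "(nat \<Rightarrow> 'e list) \<Rightarrow> nat \<Rightarrow> nat \<Rightarrow> nat \<Rightarrow> bool" where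
  "first_meeting P k m l \<longleftrightarrow> meets P k m l \<and>
     (\<forall>k'<k. \<forall>m' l'. \<not> meets P k' m' l') \<and> (\<forall>m'<m. \<forall>l'. \<not> meets P k m' l') \<and>
     (\<forall>l'<l. \<not> meets P k m l')"

lemma first_meeting_unique:
  assumes "first_meeting P k m l" "first_meeting P k' m' l'"
  shows "k = k' \<and> m = m' \<and> l = l'"
proof -
  have "k = k'" using assms unfolding first_meeting_def by (metis linorder_neqE_nat)
  moreover from this have "m = m'" using assms unfolding first_meeting_def
    by (metis linorder_neqE_nat)
  ultimately show ?thesis using assms unfolding first_meeting_def by (metis linorder_neqE_nat)
qed

lemma ex_first_meeting:
  assumes "\<not> disjoint_runs P"
  shows "\<exists>k m l. first_meeting P k m l"
proof -
  define k where "k = (LEAST k. \<exists>m l. meets P k m l)"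
  have k: "\<exists>m l. meets P k m l" unfolding k_def using assms unfolding not_disjoint_iff
    by (rule LeastI_ex)
  have k': "\<not> (\<exists>m l. meets P k' m l)" if "k' < k" for k'
    using that unfolding k_def by (rule not_less_Least)
  define m where "m = (LEAST m. \<exists>l. meets P k m l)"
  have m: "\<exists>l. meets P k m l" unfolding m_def using k by (rule LeastI_ex)
  have m': "\<not> (\<exists>l. meets P k m' l)" if "m' < m" for m'
    using that unfolding m_def by (rule not_less_Least)
  define l where "l = (LEAST l. meets P k m l)"
  have l: "meets P k m l" unfolding l_def using m by (rule LeastI_ex)
  have l': "\<not> meets P k m l'" if "l' < l" for l'
    using that unfolding l_def by (rule not_less_Least)
  show ?thesis using k' m' l l' unfolding first_meeting_def by blast
qed

definition swap_tails :: "(nat \<Rightarrow> 'e list) \<Rightarrow> nat \<Rightarrow> nat \<Rightarrow> nat \<Rightarrow> nat \<Rightarrow> nat \<Rightarrow> 'e list" where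
  "swap_tails P k m l m' =
     P(k := take m (P k) @ drop m' (P l), l := take m' (P l) @ drop m (P k))"

lemma swap_tails_families:
  assumes P: "P \<in> families \<sigma>" and k: "k < K" "l < K" "k \<noteq> l"
    and c: "state_at (a k) (P k) m = state_at (a l) (P l) m'"
  shows "swap_tails P k m l m' \<in> families (\<sigma> \<circ> Transposition.transpose k l)"
proof -
  have r: "run (a j) (P j) (b (\<sigma> j))" if "j < K" for j
    using P that by (auto simp: families_def)
  have "run (a j) (swap_tails P k m l m' j) (b ((\<sigma> \<circ> Transposition.transpose k l) j))" if "j < K" for j
    using run_splice[OF r r, OF k(1,2) c] run_splice[OF r r, OF k(2,1) c[symmetric]] r[OF that]
    by (auto simp: swap_tails_def Transposition.transpose_def)
  moreover have "swap_tails P k m l m' j = undefined" if "j \<ge> K" for j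
    using that k P by (auto simp: swap_tails_def families_def PiE_def extensional_def)
  ultimately show ?thesis by (auto simp: families_def PiE_def extensional_def)
qed

text \<open>Paths before \<open>k\<close> are untouched and meet nothing, as the two new paths together visit no new states.
Before position \<open>m\<close>, path \<open>k\<close> is unchanged; it cannot meet the new path \<open>l\<close> there, since the tail
inherited from the old path \<open>k\<close> starts at position \<open>m\<close> and the old path \<open>k\<close> is simple. At position
\<open>m\<close> itself, the partners are the same as before.\<close>

lemma first_meeting_swap_tails:
  assumes P: "P \<in> families \<sigma>" and \<sigma>: "\<sigma> permutes {..<K}"
    and f: "first_meeting P k m l" and m': "m' \<le> length (P l)"
    and c: "state_at (a k) (P k) m = state_at (a l) (P l) m'"
  shows "first_meeting (swap_tails P k m l m') k m l"
proof -
  define Q where "Q = swap_tails P k m l m'"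
  have meet: "k < K" "l < K" "k \<noteq> l" "m \<le> length (P k)"
    using f by (auto simp: first_meeting_def meets_def)
  have min_k: "\<not> meets P k' i l'" if "k' < k" for k' i l'
    using f that by (auto simp: first_meeting_def)
  have min_m: "\<not> meets P k i l'" if "i < m" for i l'
    using f that by (auto simp: first_meeting_def)
  have min_l: "\<not> meets P k m l'" if "l' < l" for l'
    using f that by (auto simp: first_meeting_def)
  \<comment> \<open>By minimality of \<open>k\<close>, the partner comes later; so paths before \<open>k\<close> are not affected.\<close>
  have "meets P l m' k"
    using meet m' c by (auto simp: meets_def visited_def intro!: rev_image_eqI[of m])
  then have kl: "k < l" using min_k meet(3) by (metis linorder_neqE_nat)
  have Qk: "Q k = take m (P k) @ drop m' (P l)" and Ql: "Q l = take m' (P l) @ drop m (P k)"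
    and Qj: "\<And>j. j \<noteq> k \<Longrightarrow> j \<noteq> l \<Longrightarrow> Q j = P j"
    using meet(3) by (auto simp: Q_def swap_tails_def)
  have Vk: "visited (a k) (Q k) =
      state_at (a k) (P k) ` {..m} \<union> state_at (a l) (P l) ` {m'..length (P l)}"
    unfolding Qk by (rule visited_splice[OF meet(4) m' c])
  have Vl: "visited (a l) (Q l) =
      state_at (a l) (P l) ` {..m'} \<union> state_at (a k) (P k) ` {m..length (P k)}"
    unfolding Ql by (rule visited_splice[OF m' meet(4) c[symmetric]])
  have sub: "visited (a k) (Q k) \<union> visited (a l) (Q l) \<subseteq> visited (a k) (P k) \<union> visited (a l) (P l)"
    unfolding Vk Vl using meet(4) m' by (auto simp: visited_def)
  have at_k: "state_at (a k) (Q k) i = state_at (a k) (P k) i" if "i \<le> m" for i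
    using state_at_splice[OF meet(4) c, of i] that unfolding Qk by simp
  have len: "length (Q k) \<ge> m" using meet(4) by (simp add: Qk)
  have inj: "inj_on (state_at (a k) (P k)) {..length (P k)}"
  proof (rule run_simple[OF meet(1)])
    show "run (a k) (P k) (b (\<sigma> k))" using P meet(1) by (auto simp: families_def)
    show "\<sigma> k < K" using \<sigma> meet(1) by (metis lessThan_iff permutes_in_image)
  qed
  have "meets Q k m l"
    unfolding meets_def using meet len at_k[of m] Vl by auto
  moreover have "\<not> meets Q k1 i l1" if k1: "k1 < k" for k1 i l1
  proof
    assume Q: "meets Q k1 i l1"
    have "Q k1 = P k1" using k1 kl by (intro Qj) auto
    with Q sub Qj[of l1] have "meets P k1 i l1 \<or> meets P k1 i k \<or> meets P k1 i l"
      unfolding meets_def using k1 kl meet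
      by (cases "l1 = k"; cases "l1 = l") auto
    then show False using min_k k1 by blast
  qed
  moreover have "\<not> meets Q k i l1" if i: "i < m" for i l1
  proof
    assume Q: "meets Q k i l1"
    then have at: "state_at (a k) (P k) i \<in> visited (a l1) (Q l1)" and l1: "l1 < K" "l1 \<noteq> k"
      using at_k[of i] i by (auto simp: meets_def)
    show False
    proof (cases "l1 = l")
      case True
      have "state_at (a k) (P k) i \<notin> state_at (a l) (P l) ` {..m'}"
      proof
        assume "state_at (a k) (P k) i \<in> state_at (a l) (P l) ` {..m'}"
        then have "meets P k i l"
          unfolding meets_def visited_def using i meet m' by auto
        then show False using min_m i by blast
      qed
      moreover have "state_at (a k) (P k) i \<notin> state_at (a k) (P k) ` {m..length (P k)}"
        using inj i meet(4) by (auto dest: inj_onD)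
      ultimately show False using at True Vl by blast
    next
      case False
      then have "meets P k i l1"
        using at l1 i meet Qj[of l1] by (auto simp: meets_def)
      then show False using min_m i by blast
    qed
  qed
  moreover have "\<not> meets Q k m l1" if l1: "l1 < l" for l1
  proof
    assume Q: "meets Q k m l1"
    then have "meets P k m l1"
      using at_k[of m] Qj[of l1] l1 meet by (auto simp: meets_def)
    then show False using min_l l1 by blast
  qed
  ultimately show ?thesis unfolding first_meeting_def Q_def[symmetric] by blast
qed

lemma swap_tails_involution:
  assumes "k \<noteq> l" "m \<le> length (P k)" "m' \<le> length (P l)"
  shows "swap_tails (swap_tails P k m l m') k m l m' = P"
  using assms by (auto simp: swap_tails_def fun_eq_iff)

lemma state_at_swap_tails:
  assumes "k \<noteq> l" "m \<le> length (P k)" "m' \<le> length (P l)"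
    "state_at (a k) (P k) m = state_at (a l) (P l) m'"
  shows "state_at (a k) (swap_tails P k m l m' k) m = state_at (a l) (swap_tails P k m l m' l) m'"
  using state_at_splice[OF assms(2,4), of m] state_at_splice[OF assms(3) assms(4)[symmetric], of m']
    assms by (simp add: swap_tails_def)

lemma swap_tails_weight:
  fixes wt :: "'e \<Rightarrow> 'w::comm_monoid_mult"
  assumes "k < K" "l < K" "k \<noteq> l"
  shows "(\<Prod>j<K. \<Prod>e\<leftarrow>swap_tails P k m l m' j. wt e) = (\<Prod>j<K. \<Prod>e\<leftarrow>P j. wt e)"
proof -
  let ?w = "\<lambda>p. \<Prod>e\<leftarrow>p. wt e"
  have split: "(\<Prod>j<K. f j) = f k * f l * (\<Prod>j\<in>{..<K} - {k,l}. f j)" for f :: "nat \<Rightarrow> 'w"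
  proof -
    have "(\<Prod>j<K. f j) = f k * (\<Prod>j\<in>{..<K} - {k}. f j)"
      using assms by (intro prod.remove) auto
    also have "(\<Prod>j\<in>{..<K} - {k}. f j) = f l * (\<Prod>j\<in>{..<K} - {k} - {l}. f j)"
      using assms by (intro prod.remove) auto
    also have "{..<K} - {k} - {l} = {..<K} - {k,l}" by auto
    finally show ?thesis by (simp add: mult.assoc)
  qed
  have "?w (swap_tails P k m l m' k) * ?w (swap_tails P k m l m' l)
      = (?w (take m (P k)) * ?w (drop m (P k))) * (?w (take m' (P l)) * ?w (drop m' (P l)))"
    using assms by (simp add: swap_tails_def mult_ac)
  also have "\<dots> = ?w (P k) * ?w (P l)"
    by (simp flip: prod_list.append map_append)
  finally show ?thesis
    unfolding split by (auto simp: swap_tails_def intro!: arg_cong2[of _ _ _ _ "(*)"] prod.cong)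
qed

text \<open>The choice is in fact forced, as \<open>switch_first_meeting_eq\<close> shows; the value on pairs with a
disjoint family is arbitrary.\<close>

definition switch_first_meeting :: "(nat \<Rightarrow> nat) \<times> (nat \<Rightarrow> 'e list) \<Rightarrow> (nat \<Rightarrow> nat) \<times> (nat \<Rightarrow> 'e list)" where
  "switch_first_meeting = (\<lambda>(\<sigma>, P). SOME x. \<exists>k m l m'. first_meeting P k m l \<and> m' \<le> length (P l) \<and>
     state_at (a k) (P k) m = state_at (a l) (P l) m' \<and>
     x = (\<sigma> \<circ> Transposition.transpose k l, swap_tails P k m l m'))"

lemma switch_first_meeting_eq:
  assumes P: "P \<in> families \<sigma>" and \<sigma>: "\<sigma> permutes {..<K}"
    and f: "first_meeting P k m l" and m': "m' \<le> length (P l)"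
    and c: "state_at (a k) (P k) m = state_at (a l) (P l) m'"
  shows "switch_first_meeting (\<sigma>, P) = (\<sigma> \<circ> Transposition.transpose k l, swap_tails P k m l m')"
  unfolding switch_first_meeting_def prod.case
proof (rule some_equality)
  fix x
  assume "\<exists>k m l m'. first_meeting P k m l \<and> m' \<le> length (P l) \<and>
     state_at (a k) (P k) m = state_at (a l) (P l) m' \<and>
     x = (\<sigma> \<circ> Transposition.transpose k l, swap_tails P k m l m')"
  then obtain k1 m1 l1 m1' where x: "first_meeting P k1 m1 l1" "m1' \<le> length (P l1)"
     "state_at (a k1) (P k1) m1 = state_at (a l1) (P l1) m1'"
     "x = (\<sigma> \<circ> Transposition.transpose k1 l1, swap_tails P k1 m1 l1 m1')" by blast
  have l: "l < K" using f by (auto simp: first_meeting_def meets_def)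
  have eq: "k1 = k" "m1 = m" "l1 = l" using first_meeting_unique[OF x(1) f] by auto
  have "inj_on (state_at (a l) (P l)) {..length (P l)}"
  proof (rule run_simple[OF l])
    show "run (a l) (P l) (b (\<sigma> l))" using P l by (auto simp: families_def)
    show "\<sigma> l < K" using \<sigma> l by (metis lessThan_iff permutes_in_image)
  qed
  then have "m1' = m'" using x(2,3) m' c eq by (auto dest: inj_onD)
  then show "x = (\<sigma> \<circ> Transposition.transpose k l, swap_tails P k m l m')" using x(4) eq by simp
qed (use f m' c in blast)

text \<open>Expanding the determinant and the products of sums gives a signed sum over all families for all
permutations. Exchanging tails at the first meeting keeps the weight and reverses the sign, so
the intersecting families contribute a number equal to its negative, which is zero in
characteristic zero.\<close>

theorem lindstroem_gessel_viennot:
  fixes wt :: "'e \<Rightarrow> 'w :: {idom, ring_char_0}"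
  shows "Determinant.det (Matrix.mat K K (\<lambda>(k, l). \<Sum>p | run (a k) p (b l). \<Prod>e\<leftarrow>p. wt e)) =
    (\<Sum>\<sigma> | \<sigma> permutes {..<K}. \<Sum>P | P \<in> families \<sigma> \<and> disjoint_runs P.
       signof \<sigma> * (\<Prod>k<K. \<Prod>e\<leftarrow>P k. wt e))"
proof -
  let ?S = "{\<sigma>. \<sigma> permutes {..<K}}"
  let ?w = "\<lambda>P. \<Prod>k<K. \<Prod>e\<leftarrow>P k. wt e"
  let ?f = "\<lambda>\<sigma> P. signof \<sigma> * ?w P"
  let ?bad = "SIGMA \<sigma>:?S. {P \<in> families \<sigma>. \<not> disjoint_runs P}"
  have im: "\<sigma> k < K" if "\<sigma> permutes {..<K}" "k < K" for \<sigma> k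
    using that by (metis lessThan_iff permutes_in_image)
  have finS: "finite ?S" by (simp add: finite_permutations)
  have fin: "finite (families \<sigma>)" if "\<sigma> \<in> ?S" for \<sigma>
    unfolding families_def using that by (intro finite_PiE finite_runs) (auto simp: im)
  have inv: "switch_first_meeting (switch_first_meeting x) = x \<and> switch_first_meeting x \<in> ?bad \<and> case_prod ?f (switch_first_meeting x) = - case_prod ?f x"
    if "x \<in> ?bad" for x
  proof -
    obtain \<sigma> P where x: "x = (\<sigma>, P)" by (cases x)
    then have \<sigma>: "\<sigma> permutes {..<K}" and P: "P \<in> families \<sigma>" and nd: "\<not> disjoint_runs P"
      using that by auto
    obtain k m l where f: "first_meeting P k m l" using ex_first_meeting[OF nd] by blast
    then have kl: "k < K" "l < K" "k \<noteq> l" "m \<le> length (P k)"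
      and "state_at (a k) (P k) m \<in> visited (a l) (P l)"
      by (auto simp: first_meeting_def meets_def)
    then obtain m' where m': "m' \<le> length (P l)"
      and c: "state_at (a k) (P k) m = state_at (a l) (P l) m'" by (auto simp: visited_def)
    define Q where "Q = swap_tails P k m l m'"
    define \<tau> where "\<tau> = \<sigma> \<circ> Transposition.transpose k l"
    have tr: "Transposition.transpose k l permutes {..<K}" using kl by (simp add: permutes_swap_id)
    have \<tau>: "\<tau> permutes {..<K}" unfolding \<tau>_def using tr \<sigma> by (rule permutes_compose)
    have Q: "Q \<in> families \<tau>" unfolding Q_def \<tau>_def by (rule swap_tails_families[OF P kl(1-3) c])
    have fQ: "first_meeting Q k m l" unfolding Q_def by (rule first_meeting_swap_tails[OF P \<sigma> f m' c])
    have mQ: "m' \<le> length (Q l)" using m' kl by (simp add: Q_def swap_tails_def)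
    have cQ: "state_at (a k) (Q k) m = state_at (a l) (Q l) m'"
      unfolding Q_def by (rule state_at_swap_tails[OF kl(3,4) m' c])
    have ux: "switch_first_meeting x = (\<tau>, Q)" unfolding x Q_def \<tau>_def by (rule switch_first_meeting_eq[OF P \<sigma> f m' c])
    have "switch_first_meeting (\<tau>, Q) = (\<tau> \<circ> Transposition.transpose k l, swap_tails Q k m l m')"
      by (rule switch_first_meeting_eq[OF Q \<tau> fQ mQ cQ])
    also have "\<dots> = x"
      unfolding x Q_def \<tau>_def swap_tails_involution[OF kl(3,4) m'] by (simp add: comp_assoc)
    finally have "switch_first_meeting (switch_first_meeting x) = x" by (simp add: ux)
    moreover have "\<not> disjoint_runs Q"
      using fQ by (auto simp: not_disjoint_iff first_meeting_def)
    moreover have "(signof \<tau> :: 'w) = - signof \<sigma>"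
      unfolding \<tau>_def using kl \<sigma> finite_lessThan[of K] tr
      by (subst sign_compose) (auto simp: sign_swap_id permutation_permutes)
    moreover have "?w Q = ?w P" unfolding Q_def by (rule swap_tails_weight[OF kl(1-3)])
    ultimately show ?thesis using \<tau> Q ux x by auto
  qed
  define S where "S = sum (case_prod ?f) ?bad"
  have "S = (\<Sum>x\<in>?bad. - case_prod ?f x)"
    unfolding S_def by (rule sum.reindex_bij_witness[of _ switch_first_meeting switch_first_meeting]) (use inv in auto)
  also have "\<dots> = - S" by (simp only: sum_negf S_def)
  finally have "2 * S = 0" by (metis ab_left_minus mult_2)
  then have "S = 0" by simp
  then have bad: "(\<Sum>\<sigma>\<in>?S. \<Sum>P | P \<in> families \<sigma> \<and> \<not> disjoint_runs P. ?f \<sigma> P) = 0"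
    using finS fin unfolding S_def by (subst sum.Sigma) auto
  have "Determinant.det (Matrix.mat K K (\<lambda>(k, l). \<Sum>p | run (a k) p (b l). \<Prod>e\<leftarrow>p. wt e)) =
    (\<Sum>\<sigma>\<in>?S. signof \<sigma> * (\<Prod>k<K. \<Sum>p | run (a k) p (b (\<sigma> k)). \<Prod>e\<leftarrow>p. wt e))"
    unfolding Determinant.det_def using im
    by (auto simp: atLeast0LessThan intro!: sum.cong prod.cong)
  also have "\<dots> = (\<Sum>\<sigma>\<in>?S. \<Sum>P\<in>families \<sigma>. ?f \<sigma> P)"
    unfolding families_def
    by (intro sum.cong refl, subst prod_sum_PiE) (auto simp: im finite_runs sum_distrib_left)
  also have "\<dots> = (\<Sum>\<sigma>\<in>?S. (\<Sum>P | P \<in> families \<sigma> \<and> disjoint_runs P. ?f \<sigma> P)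
      + (\<Sum>P | P \<in> families \<sigma> \<and> \<not> disjoint_runs P. ?f \<sigma> P))"
  proof (intro sum.cong refl)
    fix \<sigma> assume "\<sigma> \<in> ?S"
    then show "(\<Sum>P\<in>families \<sigma>. ?f \<sigma> P) = (\<Sum>P | P \<in> families \<sigma> \<and> disjoint_runs P. ?f \<sigma> P)
      + (\<Sum>P | P \<in> families \<sigma> \<and> \<not> disjoint_runs P. ?f \<sigma> P)"
      using fin by (subst sum.union_disjoint[symmetric]) (auto intro!: sum.cong)
  qed
  also have "\<dots> = (\<Sum>\<sigma>\<in>?S. \<Sum>P | P \<in> families \<sigma> \<and> disjoint_runs P. ?f \<sigma> P)"
    by (simp add: sum.distrib bad)
  finally show ?thesis .
qed

text \<open>If paths with sources and sinks in opposite order always meet, then the permutation of a disjoint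
family is increasing, and the only increasing permutation of an initial segment is the identity.\<close>

corollary lindstroem_gessel_viennot_planar:
  fixes wt :: "'e \<Rightarrow> 'w :: {idom, ring_char_0}"
  assumes cross: "\<And>k k' l l' p q. k < k' \<Longrightarrow> k' < K \<Longrightarrow> l < l' \<Longrightarrow> l' < K \<Longrightarrow>
    run (a k) p (b l') \<Longrightarrow> run (a k') q (b l) \<Longrightarrow> visited (a k) p \<inter> visited (a k') q \<noteq> {}"
  shows "Determinant.det (Matrix.mat K K (\<lambda>(k, l). \<Sum>p | run (a k) p (b l). \<Prod>e\<leftarrow>p. wt e)) =
    (\<Sum>P | P \<in> families id \<and> disjoint_runs P. \<Prod>k<K. \<Prod>e\<leftarrow>P k. wt e)"
proof -
  have "{P \<in> families \<sigma>. disjoint_runs P} = {}" if \<sigma>: "\<sigma> permutes {..<K}" "\<sigma> \<noteq> id" for \<sigma>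
  proof (rule ccontr)
    assume "{P \<in> families \<sigma>. disjoint_runs P} \<noteq> {}"
    then obtain P where P: "P \<in> families \<sigma>" and d: "disjoint_runs P" by blast
    have im: "\<sigma> k < K" if "k < K" for k
      using that \<sigma>(1) by (metis lessThan_iff permutes_in_image)
    have "strict_mono_on {..<K} \<sigma>"
    proof (rule strict_mono_onI)
      fix k k' assume k: "k \<in> {..<K}" "k' \<in> {..<K}" "k < k'"
      have "\<not> \<sigma> k' < \<sigma> k"
      proof
        assume "\<sigma> k' < \<sigma> k"
        then have "visited (a k) (P k) \<inter> visited (a k') (P k') \<noteq> {}"
          using k P im by (intro cross[of k k' "\<sigma> k'" "\<sigma> k"]) (auto simp: families_def)
        then show False using d k unfolding disjoint_runs_def by auto
      qed
      moreover have "\<sigma> k \<noteq> \<sigma> k'" using k(3) permutes_inj[OF \<sigma>(1)] by (auto dest: injD)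
      ultimately show "\<sigma> k < \<sigma> k'" by simp
    qed
    have le: "k \<le> \<sigma> k" if "k < K" for k
      using that
    proof (induction k)
      case (Suc k)
      then have "\<sigma> k < \<sigma> (Suc k)"
        using strict_mono_onD[OF \<open>strict_mono_on {..<K} \<sigma>\<close>] by simp
      then show ?case using Suc by simp
    qed simp
    have "\<sigma> = id"
    proof (rule ccontr)
      assume "\<sigma> \<noteq> id"
      then show False
      proof -
        \<comment> \<open>Each value is at least its argument and the sums agree, so all of them are equal.\<close>
        have "\<forall>k\<in>{..<K}. k \<le> \<sigma> k" using le by simp
        then have "\<forall>k\<in>{..<K}. \<sigma> k = k"
        proof -
          have s: "(\<Sum>k<K. \<sigma> k) = (\<Sum>k<K. k)"
            using sum.permute[OF \<sigma>(1), of "\<lambda>k. k"] by (simp add: comp_def)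
          show ?thesis
            using sum_mono_inv[of "\<lambda>k. k" "{..<K}" \<sigma>] s le by fastforce
        qed
        then show False using \<open>\<sigma> \<noteq> id\<close> \<sigma>(1) unfolding permutes_def by (metis eq_id_iff)
      qed
    qed
    with \<sigma>(2) show False by simp
  qed
  then have *: "(\<Sum>P | P \<in> families \<sigma> \<and> disjoint_runs P. signof \<sigma> * (\<Prod>k<K. \<Prod>e\<leftarrow>P k. wt e)) = 0"
    if "\<sigma> permutes {..<K}" "\<sigma> \<noteq> id" for \<sigma>
    using that by (metis (mono_tags, lifting) empty_Collect_eq sum.empty)
  show ?thesis
    unfolding lindstroem_gessel_viennot
    using * by (subst sum.mono_neutral_right[of _ "{id}"])
      (auto simp: finite_permutations permutes_id)
qed

end

section \<open>Crossing paths in the strip\<close>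

text \<open>The Fashoda theorem for \<open>real^2\<close>, carried over to pairs, in which the strip is described.\<close>

lemma fashoda_prod:
  fixes f g :: "real \<Rightarrow> real \<times> real"
  assumes "path f" "path g" "path_image f \<subseteq> {a..b} \<times> {c..d}" "path_image g \<subseteq> {a..b} \<times> {c..d}"
    and "fst (pathstart f) = a" "fst (pathfinish f) = b"
    and "snd (pathstart g) = c" "snd (pathfinish g) = d"
  shows "path_image f \<inter> path_image g \<noteq> {}"
proof -
  define V where "V = (\<lambda>x::real \<times> real. \<chi> i::2. if i = 1 then fst x else snd x)"
  have V1: "Finite_Cartesian_Product.vec_nth (V x) 1 = fst x"
    and V2: "Finite_Cartesian_Product.vec_nth (V x) 2 = snd x" for x
    by (simp_all add: V_def)
  have inj: "inj V"
    by (rule injI) (metis V1 V2 prod.expand)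
  have "continuous_on UNIV V"
    unfolding V_def
  proof (rule continuous_on_vec_lambda)
    show "continuous_on UNIV (\<lambda>x. if i = 1 then fst x else snd x)" for i :: 2
      by (cases "i = 1") (auto intro!: continuous_intros)
  qed
  then have cont: "continuous_on S V" for S using continuous_on_subset by blast
  have box: "V ` ({a..b} \<times> {c..d}) \<subseteq> cbox (V (a, c)) (V (b, d))"
    by (auto simp: mem_box_cart forall_2 V1 V2)
  obtain z where "z \<in> path_image (V \<circ> f)" "z \<in> path_image (V \<circ> g)"
  proof (rule fashoda[of "V \<circ> f" "V \<circ> g" "V (a, c)" "V (b, d)"])
    show "path (V \<circ> f)" "path (V \<circ> g)"
      using assms cont by (auto intro!: path_continuous_image)
    show "path_image (V \<circ> f) \<subseteq> cbox (V (a, c)) (V (b, d))"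
      "path_image (V \<circ> g) \<subseteq> cbox (V (a, c)) (V (b, d))"
      unfolding path_image_compose using assms(3,4) box by (meson image_mono order_trans)+
  qed (use assms in \<open>auto simp: pathstart_compose pathfinish_compose V1 V2\<close>)
  then show ?thesis
    using inj by (auto simp: path_image_compose dest!: injD)
qed

text \<open>The two paths are prolonged to a large box, beyond the strip: the first by slanted segments to the
left and right edges, the second by vertical segments to the bottom and top edges. As the start of
the first path lies to the left of that of the second, and their ends are in reverse order, the
added segments can meet the other prolonged path only in its end on the boundary of the strip, so the
common point given by the Fashoda theorem is on both original paths.\<close>

lemma strip_paths_cross:
  fixes f g :: "real \<Rightarrow> real \<times> real"
  assumes f: "path f" "path_image f \<subseteq> strip" "pathstart f = (f0, 0)" "pathfinish f = (f1, 1)"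
    and g: "path g" "path_image g \<subseteq> strip" "pathstart g = (g0, 0)" "pathfinish g = (g1, 1)"
    and order: "f0 < g0" "g1 < f1"
  shows "path_image f \<inter> path_image g \<noteq> {}"
proof -
  obtain M where M: "\<And>x. x \<in> path_image f \<union> path_image g \<Longrightarrow> \<bar>fst x\<bar> \<le> M"
  proof -
    have "bounded (fst ` (path_image f \<union> path_image g))"
      using f(1) g(1) by (intro compact_imp_bounded compact_continuous_image continuous_intros
          compact_Un compact_path_image)
    then show thesis using that unfolding bounded_iff by (metis imageI real_norm_def)
  qed
  have ends: "(f0, 0) \<in> path_image f" "(f1, 1) \<in> path_image f" "(g0, 0) \<in> path_image g" "(g1, 1) \<in> path_image g"
    using f g by (metis pathstart_in_path_image pathfinish_in_path_image)+
  have b: "\<bar>f0\<bar> \<le> M" "\<bar>f1\<bar> \<le> M" "\<bar>g0\<bar> \<le> M" "\<bar>g1\<bar> \<le> M" using ends M[of "(f0,0)"] M[of "(f1,1)"] M[of "(g0,0)"] M[of "(g1,1)"] by auto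
  define F where "F = (linepath (-M, -1) (f0, 0) +++ f) +++ linepath (f1, 1) (M, 2)"
  define G where "G = (linepath (g0, -1) (g0, 0) +++ g) +++ linepath (g1, 1) (g1, 2)"
  have imF: "path_image F = closed_segment (-M, -1) (f0, 0) \<union> path_image f \<union> closed_segment (f1, 1) (M, 2)"
    using f by (simp add: F_def path_image_join)
  have imG: "path_image G = closed_segment (g0, -1) (g0, 0) \<union> path_image g \<union> closed_segment (g1, 1) (g1, 2)"
    using g by (simp add: G_def path_image_join)
  have inner: "path_image f \<subseteq> {-M..M} \<times> {-1..2}" "path_image g \<subseteq> {-M..M} \<times> {-1..2}"
    using f(2) g(2) M unfolding strip_def by (force simp: abs_le_iff)+
  have seg: "closed_segment x y \<subseteq> {-M..M} \<times> {-1..2}" if "x \<in> {-M..M} \<times> {-1..2}" "y \<in> {-M..M} \<times> {-1..2::real}" for x y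
    using that by (intro closed_segment_subset convex_Times) auto
  have "path_image F \<inter> path_image G \<noteq> {}"
  proof (rule fashoda_prod[of F G "-M" M "-1" 2])
    show "path F" "path G" using f g by (simp_all add: F_def G_def)
    show "path_image F \<subseteq> {-M..M} \<times> {-1..2}" "path_image G \<subseteq> {-M..M} \<times> {-1..2}"
      unfolding imF imG using inner b by (intro seg Un_least; simp add: abs_le_iff)+
  qed (auto simp: F_def G_def)
  then obtain z where z: "z \<in> path_image F" "z \<in> path_image G" by blast
  have low: "fst x \<le> f0 \<and> snd x \<le> 0 \<and> (snd x = 0 \<longrightarrow> x = (f0, 0))"
    if *: "x \<in> closed_segment (-M, -1) (f0, 0)" for x :: "real \<times> real"
  proof -
    obtain u where u: "0 \<le> u" "u \<le> 1" "x = ((1 - u) * (-M) + u * f0, (1 - u) * (-1))"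
      using * unfolding closed_segment_def by force
    have "(1 - u) * (-M) \<le> (1 - u) * f0" using u b by (intro mult_left_mono) auto
    then show ?thesis using u by (auto simp: algebra_simps)
  qed
  have high: "fst x \<ge> f1 \<and> snd x \<ge> 1 \<and> (snd x = 1 \<longrightarrow> x = (f1, 1))"
    if *: "x \<in> closed_segment (f1, 1) (M, 2)" for x :: "real \<times> real"
  proof -
    obtain u where u: "0 \<le> u" "u \<le> 1" "x = ((1 - u) * f1 + u * M, (1 - u) + u * 2)"
      using * unfolding closed_segment_def by force
    have "u * f1 \<le> u * M" using u b by (intro mult_left_mono) auto
    then show ?thesis using u by (auto simp: algebra_simps)
  qed
  have lowG: "fst x = g0 \<and> snd x \<le> 0 \<and> (snd x = 0 \<longrightarrow> x = (g0, 0))"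
    if "x \<in> closed_segment (g0, -1) (g0, 0)" for x :: "real \<times> real"
    using that by (auto simp: closed_segment_def algebra_simps)
  have highG: "fst x = g1 \<and> snd x \<ge> 1 \<and> (snd x = 1 \<longrightarrow> x = (g1, 1))"
    if "x \<in> closed_segment (g1, 1) (g1, 2)" for x :: "real \<times> real"
    using that by (auto simp: closed_segment_def algebra_simps)
  have mid: "0 \<le> snd x \<and> snd x \<le> 1" if "x \<in> path_image f \<union> path_image g" for x
    using that f(2) g(2) by (auto simp: strip_def)
  consider "z \<in> closed_segment (-M, -1) (f0, 0)" | "z \<in> path_image f" | "z \<in> closed_segment (f1, 1) (M, 2)"
    using z(1) imF by blast
  then have "z \<in> path_image f"
  proof cases
    case 1
    then show ?thesis using z(2) imG low[of z] lowG[of z] highG[of z] mid[of z] order ends by auto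
  next
    case 3
    then show ?thesis using z(2) imG high[of z] lowG[of z] highG[of z] mid[of z] order ends by auto
  qed
  moreover have "z \<in> path_image g"
    using z(2) imG lowG[of z] highG[of z] mid[of z] ends \<open>z \<in> path_image f\<close> by auto
  ultimately show ?thesis by blast
qed

section \<open>The two sides of a chord in the strip\<close>

text \<open>The shape of each lift of the chord. That only its ends are on the boundary lines makes the rest of
each boundary line lie on one side.\<close>

locale strip_chord =
  fixes h :: "real \<Rightarrow> real \<times> real" and a b :: real
  assumes arc_h: "arc h" and h_start: "pathstart h = (a, 0)" and h_finish: "pathfinish h = (b, 1)"
    and h_interior: "t \<in> {0<..<1} \<Longrightarrow> snd (h t) \<in> {0<..<1}"
begin

lemma h_values:
  assumes "x \<in> path_image h"
  shows "x = (a, 0) \<or> x = (b, 1) \<or> snd x \<in> {0<..<1}"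
proof -
  obtain t where t: "t \<in> {0..1}" "x = h t" using assms by (auto simp: path_image_def)
  then consider "t = 0" | "t = 1" | "t \<in> {0<..<1}" by (auto simp: less_le)
  then show ?thesis
    using t(2) h_start h_finish h_interior by cases (auto simp: pathstart_def pathfinish_def)
qed

lemma h_in_strip: "path_image h \<subseteq> strip"
  using h_values by (force simp: strip_def)

lemma h_bounded:
  obtains B where "\<And>x. x \<in> path_image h \<Longrightarrow> \<bar>fst x\<bar> \<le> B"
proof -
  have "bounded (fst ` path_image h)"
    using arc_h by (intro compact_imp_bounded compact_continuous_image continuous_intros
        compact_path_image arc_imp_path)
  then show thesis using that unfolding bounded_iff by (metis imageI real_norm_def)
qed

lemma left_connected:
  assumes B: "\<And>x. x \<in> path_image h \<Longrightarrow> B \<le> fst x" and xy: "x \<in> strip" "y \<in> strip" "fst x < B" "fst y < B"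
  shows "connected_component (strip - path_image h) x y"
proof (rule connected_componentI)
  show "topological_space_class.connected ({..<B} \<times> {0..1::real})" by (intro convex_connected convex_Times) auto
  show "{..<B} \<times> {0..1} \<subseteq> strip - path_image h" using B by (force simp: strip_def)
qed (use xy in \<open>auto simp: strip_def mem_Times_iff\<close>)

lemma right_connected:
  assumes B: "\<And>x. x \<in> path_image h \<Longrightarrow> fst x \<le> B" and xy: "x \<in> strip" "y \<in> strip" "B < fst x" "B < fst y"
  shows "connected_component (strip - path_image h) x y"
proof (rule connected_componentI)
  show "topological_space_class.connected ({B<..} \<times> {0..1::real})" by (intro convex_connected convex_Times) auto
  show "{B<..} \<times> {0..1} \<subseteq> strip - path_image h" using B by (force simp: strip_def)
qed (use xy in \<open>auto simp: strip_def mem_Times_iff\<close>)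

lemma cw_sideI:
  assumes B: "\<And>x. x \<in> path_image h \<Longrightarrow> B \<le> fst x" and x: "x \<in> strip" "fst x < B"
  shows "x \<in> cw_side h"
  unfolding cw_side_def using left_connected[OF B] x by blast

lemma ccw_sideI:
  assumes B: "\<And>x. x \<in> path_image h \<Longrightarrow> fst x \<le> B" and x: "x \<in> strip" "B < fst x"
  shows "x \<in> ccw_side h"
  unfolding ccw_side_def using right_connected[OF B] x by blast

lemma side_connected:
  assumes "connected_component (strip - path_image h) x y"
  shows "x \<in> cw_side h \<longleftrightarrow> y \<in> cw_side h" "x \<in> ccw_side h \<longleftrightarrow> y \<in> ccw_side h"
  unfolding cw_side_def ccw_side_def mem_Collect_eq
  by (meson assms connected_component_sym connected_component_trans)+

lemma side_connected_set:
  assumes "topological_space_class.connected S" "S \<subseteq> strip - path_image h" "x \<in> S" "y \<in> S"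
  shows "x \<in> cw_side h \<longleftrightarrow> y \<in> cw_side h" "x \<in> ccw_side h \<longleftrightarrow> y \<in> ccw_side h"
  using assms by (auto intro!: side_connected connected_componentI)

lemma side_subset: "cw_side h \<subseteq> strip - path_image h" "ccw_side h \<subseteq> strip - path_image h"
proof -
  have 1: "\<exists>y\<in>strip. fst y < M" for M :: real
    by (rule bexI[of _ "(M - 1, 0)"]) (auto simp: strip_def)
  have 2: "\<exists>y\<in>strip. M < fst y" for M :: real
    by (rule bexI[of _ "(M + 1, 0)"]) (auto simp: strip_def)
  show "cw_side h \<subseteq> strip - path_image h" "ccw_side h \<subseteq> strip - path_image h"
    unfolding cw_side_def ccw_side_def using 1 2 connected_component_in by fast+
qed

lemma bottom_sides:
  "x < a \<Longrightarrow> (x, 0) \<in> cw_side h" "a < x \<Longrightarrow> (x, 0) \<in> ccw_side h"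
proof -
  obtain B where B: "\<And>x. x \<in> path_image h \<Longrightarrow> \<bar>fst x\<bar> \<le> B" using h_bounded by blast
  assume x: "x < a"
  have "(min x (- B - 1), 0) \<in> cw_side h"
    by (rule cw_sideI[of "- B"]) (use B in \<open>force simp: strip_def\<close>)+
  moreover have "{..<a} \<times> {0} \<subseteq> strip - path_image h"
    using h_values by (force simp: strip_def)
  ultimately show "(x, 0) \<in> cw_side h"
    using side_connected_set(1)[of "{..<a} \<times> {0}" "(x, 0)" "(min x (- B - 1), 0)"] x
    by (simp add: convex_connected convex_Times)
next
  obtain B where B: "\<And>x. x \<in> path_image h \<Longrightarrow> \<bar>fst x\<bar> \<le> B" using h_bounded by blast
  assume x: "a < x"
  have "(max x (B + 1), 0) \<in> ccw_side h"
    by (rule ccw_sideI[of B]) (use B in \<open>force simp: strip_def\<close>)+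
  moreover have "{a<..} \<times> {0} \<subseteq> strip - path_image h"
    using h_values by (force simp: strip_def)
  ultimately show "(x, 0) \<in> ccw_side h"
    using side_connected_set(2)[of "{a<..} \<times> {0}" "(x, 0)" "(max x (B + 1), 0)"] x
    by (simp add: convex_connected convex_Times)
qed

lemma top_sides:
  "x < b \<Longrightarrow> (x, 1) \<in> cw_side h" "b < x \<Longrightarrow> (x, 1) \<in> ccw_side h"
proof -
  obtain B where B: "\<And>x. x \<in> path_image h \<Longrightarrow> \<bar>fst x\<bar> \<le> B" using h_bounded by blast
  assume x: "x < b"
  have "(min x (- B - 1), 1) \<in> cw_side h"
    by (rule cw_sideI[of "- B"]) (use B in \<open>force simp: strip_def\<close>)+
  moreover have "{..<b} \<times> {1} \<subseteq> strip - path_image h"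
    using h_values by (force simp: strip_def)
  ultimately show "(x, 1) \<in> cw_side h"
    using side_connected_set(1)[of "{..<b} \<times> {1}" "(x, 1)" "(min x (- B - 1), 1)"] x
    by (simp add: convex_connected convex_Times)
next
  obtain B where B: "\<And>x. x \<in> path_image h \<Longrightarrow> \<bar>fst x\<bar> \<le> B" using h_bounded by blast
  assume x: "b < x"
  have "(max x (B + 1), 1) \<in> ccw_side h"
    by (rule ccw_sideI[of B]) (use B in \<open>force simp: strip_def\<close>)+
  moreover have "{b<..} \<times> {1} \<subseteq> strip - path_image h"
    using h_values by (force simp: strip_def)
  ultimately show "(x, 1) \<in> ccw_side h"
    using side_connected_set(2)[of "{b<..} \<times> {1}" "(x, 1)" "(max x (B + 1), 1)"] x
    by (simp add: convex_connected convex_Times)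
qed

text \<open>A path in the complement from far left on the bottom to far right on the top would have to
cross the chord. Such a path exists as soon as the two ends are connected, since the complement of
the chord in the strip is locally path connected.\<close>

lemma sides_disjoint: "cw_side h \<inter> ccw_side h = {}"
proof (rule ccontr)
  assume "cw_side h \<inter> ccw_side h \<noteq> {}"
  then obtain x where x: "x \<in> cw_side h" "x \<in> ccw_side h" by blast
  obtain L where L: "\<And>y. y \<in> strip \<Longrightarrow> fst y < L \<Longrightarrow> connected_component (strip - path_image h) x y"
    using x(1) unfolding cw_side_def by blast
  obtain R where R: "\<And>y. y \<in> strip \<Longrightarrow> R < fst y \<Longrightarrow> connected_component (strip - path_image h) x y"
    using x(2) unfolding ccw_side_def by blast
  define l r where "l = (min L a - 1, 0::real)" and "r = (max R b + 1, 1::real)"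
  have "connected_component (strip - path_image h) x l" "connected_component (strip - path_image h) x r"
    by (intro L R; simp add: l_def r_def strip_def)+
  then have "connected_component (strip - path_image h) l r"
    by (meson connected_component_sym connected_component_trans)
  moreover have "locally path_connected (strip - path_image h)"
    using arc_h
    by (intro locally_diff_closed closed_subset h_in_strip convex_imp_locally_path_connected
        closed_path_image arc_imp_path) (auto simp: strip_def convex_Times)
  ultimately have "path_component (strip - path_image h) l r"
    by (simp add: path_component_eq_connected_component)
  then obtain g where g: "path g" "path_image g \<subseteq> strip - path_image h" "pathstart g = l" "pathfinish g = r"
    unfolding path_component_def by blast
  have "path_image g \<inter> path_image h \<noteq> {}"
    by (rule strip_paths_cross[of g "fst l" "fst r" h a b])
      (use g arc_h h_in_strip h_start h_finish in \<open>auto simp: l_def r_def arc_imp_path\<close>)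
  with g(2) show False by blast
qed

text \<open>A component \<open>S\<close> of the complement that belongs to neither side contains no point of the boundary lines.
So \<open>S\<close> is open in the plane, and it is relatively closed in the complement of the chord in the plane.
As an arc does not separate the plane, \<open>S\<close> would be that whole complement, which reaches out of the strip.\<close>

lemma sides_cover: "strip - path_image h \<subseteq> cw_side h \<union> ccw_side h"
proof
  fix x assume x: "x \<in> strip - path_image h"
  define S where "S = connected_component_set (strip - path_image h) x"
  have xS: "x \<in> S" using x by (simp add: S_def)
  have S_sub: "S \<subseteq> strip - path_image h" by (simp add: S_def connected_component_subset)
  show "x \<in> cw_side h \<union> ccw_side h"
  proof (rule ccontr)
    assume n: "x \<notin> cw_side h \<union> ccw_side h"
    have nS: "y \<notin> cw_side h \<union> ccw_side h" if "y \<in> S" for y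
      using that n side_connected[of x y] by (auto simp: S_def)
    have int: "snd y \<in> {0<..<1}" if y: "y \<in> S" for y
    proof (rule ccontr)
      assume "snd y \<notin> {0<..<1}"
      moreover have "y \<in> strip" "y \<notin> path_image h" using y S_sub by auto
      ultimately consider "y = (fst y, 0)" | "y = (fst y, 1)"
        by (cases y) (force simp: strip_def)
      then show False
      proof cases
        case 1
        then have "fst y \<noteq> a" using \<open>y \<notin> path_image h\<close> h_start pathstart_in_path_image by metis
        then show False using bottom_sides[of "fst y"] nS[OF y] 1 by (metis Un_iff linorder_neqE)
      next
        case 2
        then have "fst y \<noteq> b" using \<open>y \<notin> path_image h\<close> h_finish pathfinish_in_path_image by metis
        then show False using top_sides[of "fst y"] nS[OF y] 2 by (metis Un_iff linorder_neqE)
      qed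
    qed
    define D where "D = (UNIV \<times> {0<..<1::real}) - path_image h"
    have "open D"
      unfolding D_def using arc_h by (intro open_Diff open_Times closed_path_image arc_imp_path) auto
    have SD: "S = connected_component_set D x"
    proof
      have "S \<subseteq> D" using int S_sub by (auto simp: D_def mem_Times_iff)
      then show "S \<subseteq> connected_component_set D x"
        using xS by (intro connected_component_maximal) (auto simp: S_def connected_connected_component)
      show "connected_component_set D x \<subseteq> S"
        unfolding S_def by (rule connected_component_mono) (auto simp: D_def strip_def)
    qed
    have "open S" unfolding SD using \<open>open D\<close> by (rule open_connected_component)
    obtain E where E: "closed E" "S = (strip - path_image h) \<inter> E"
    proof -
      have "closedin (top_of_set (strip - path_image h)) S"
        unfolding S_def by (rule closedin_connected_component)
      then show thesis using that by (auto simp: closedin_closed)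
    qed
    have "closed strip" unfolding strip_def by (intro closed_Times) auto
    have "topological_space_class.connected (- path_image h)"
      by (rule connected_arc_complement[OF arc_h]) simp
    moreover have "openin (top_of_set (- path_image h)) S"
      using \<open>open S\<close> S_sub by (auto simp: openin_open)
    moreover have "closedin (top_of_set (- path_image h)) S"
      unfolding closedin_closed using E \<open>closed strip\<close> by (intro exI[of _ "strip \<inter> E"]) auto
    ultimately have "S = - path_image h"
      unfolding connected_clopen using xS by blast
    moreover have "(0, 2) \<notin> path_image h" using h_in_strip by (auto simp: strip_def)
    ultimately show False using int[of "(0, 2)"] by auto
  qed
qed

end

section \<open>Counting changes of side\<close>

lemma eventually_eq_const:
  assumes "F \<noteq> bot" "\<forall>\<^sub>F s in F. P s = c"
  shows "(\<forall>\<^sub>F s in F. P s) = c" "(\<forall>\<^sub>F s in F. \<not> P s) = (\<not> c)"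
proof -
  have "\<not> ((\<forall>\<^sub>F s in F. P s) \<and> (\<forall>\<^sub>F s in F. \<not> P s))"
  proof
    assume "(\<forall>\<^sub>F s in F. P s) \<and> (\<forall>\<^sub>F s in F. \<not> P s)"
    then have "\<forall>\<^sub>F s in F. P s \<and> \<not> P s" by (intro eventually_conj) auto
    with assms(1) show False by (simp add: trivial_limit_def)
  qed
  moreover have "c \<Longrightarrow> \<forall>\<^sub>F s in F. P s" "\<not> c \<Longrightarrow> \<forall>\<^sub>F s in F. \<not> P s"
    using assms(2) by (auto elim: eventually_mono)
  ultimately show "(\<forall>\<^sub>F s in F. P s) = c" "(\<forall>\<^sub>F s in F. \<not> P s) = (\<not> c)"
    by blast+
qed

text \<open>For a predicate that only changes at finitely many points, the upward and downward changes telescope.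
Changes are recognized by the one-sided limits, so a point of \<open>F\<close> at which the predicate returns to
its former value counts zero. Induction splits off the last point of \<open>F\<close>.\<close>

lemma count_changes:
  fixes P :: "real \<Rightarrow> bool"
  assumes "finite F" "F \<subseteq> {u<..<v}" "u < v"
    and "\<And>x y. u \<le> x \<Longrightarrow> x \<le> y \<Longrightarrow> y \<le> v \<Longrightarrow> {x..y} \<inter> F = {} \<Longrightarrow> P x = P y"
  shows "int (card {t\<in>F. (\<forall>\<^sub>F s in at_left t. \<not> P s) \<and> (\<forall>\<^sub>F s in at_right t. P s)})
       - int (card {t\<in>F. (\<forall>\<^sub>F s in at_left t. P s) \<and> (\<forall>\<^sub>F s in at_right t. \<not> P s)})
       = of_bool (P v) - of_bool (P u)"
  using assms
proof (induction F arbitrary: v rule: finite_linorder_max_induct)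
  case empty
  then show ?case by (simp add: empty(3)[of u v])
next
  case (insert t F)
  let ?up = "\<lambda>t. (\<forall>\<^sub>F s in at_left t. \<not> P s) \<and> (\<forall>\<^sub>F s in at_right t. P s)"
  let ?down = "\<lambda>t. (\<forall>\<^sub>F s in at_left t. P s) \<and> (\<forall>\<^sub>F s in at_right t. \<not> P s)"
  have t: "u < t" "t < v" using insert.prems by auto
  \<comment> \<open>A point between the last change \<open>t\<close> and all earlier ones; \<open>u\<close> is inserted in case there are none.\<close>
  define w where "w = (Max (insert u F) + t) / 2"
  have mx: "u \<le> Max (insert u F)" "\<And>x. x \<in> F \<Longrightarrow> x \<le> Max (insert u F)" "Max (insert u F) < t"
    using insert.hyps t by auto
  have w: "u < w" "w < t" "\<And>x. x \<in> F \<Longrightarrow> x < w"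
    using mx unfolding w_def by (force simp: field_simps)+
  have IH: "int (card {t\<in>F. ?up t}) - int (card {t\<in>F. ?down t}) = of_bool (P w) - of_bool (P u)"
  proof (rule insert.IH)
    show "F \<subseteq> {u<..<w}" using insert.prems(1) w by auto
    show "P x = P y" if "u \<le> x" "x \<le> y" "y \<le> w" "{x..y} \<inter> F = {}" for x y
      using that w t by (intro insert.prems(3)) auto
  qed (use w in auto)
  have left: "P s = P w" if "w \<le> s" "s < t" for s
    using that w t by (intro insert.prems(3)[of w s, symmetric]) force+
  have right: "P s = P v" if "t < s" "s \<le> v" for s
    using that w t by (intro insert.prems(3)[of s v]) force+
  have "\<forall>\<^sub>F s in at_left t. s \<in> {w<..<t}" "\<forall>\<^sub>F s in at_right t. s \<in> {t<..<v}"
    using w t eventually_at_left_real eventually_at_right_real by blast+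
  note near = this
  have "\<forall>\<^sub>F s in at_left t. P s = P w" "\<forall>\<^sub>F s in at_right t. P s = P v"
    by (rule eventually_mono[OF near(1)], rule left, simp, simp)
      (rule eventually_mono[OF near(2)], rule right, simp, simp)
  note eq = this
  have lr: "(\<forall>\<^sub>F s in at_left t. \<not> P s) = (\<not> P w)" "(\<forall>\<^sub>F s in at_left t. P s) = P w"
    "(\<forall>\<^sub>F s in at_right t. \<not> P s) = (\<not> P v)" "(\<forall>\<^sub>F s in at_right t. P s) = P v"
    using eventually_eq_const[OF _ eq(1)] eventually_eq_const[OF _ eq(2)] by simp_all
  have "t \<notin> F" using insert.hyps(2) by auto
  have "{x \<in> insert t F. Q x} = (if Q t then insert t {x\<in>F. Q x} else {x\<in>F. Q x})" for Q by auto
  then have card: "int (card {x \<in> insert t F. Q x}) = of_bool (Q t) + int (card {x\<in>F. Q x})" for Q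
    using \<open>t \<notin> F\<close> insert.hyps(1) by simp
  show ?case
    unfolding card using IH lr by auto
qed

section \<open>The covering of the cylinder by the strip\<close>

text \<open>The deck transformations of the covering of the cylinder by the strip.\<close>

definition shift :: "int \<Rightarrow> real \<times> real \<Rightarrow> real \<times> real" where
  "shift k x = (fst x + 2 * pi * of_int k, snd x)"

lemma fst_shift [simp]: "fst (shift k x) = fst x + 2 * pi * of_int k"
  and snd_shift [simp]: "snd (shift k x) = snd x"
  by (simp_all add: shift_def)

lemma shift_0 [simp]: "shift 0 x = x"
  by (simp add: shift_def)

lemma shift_shift [simp]: "shift k (shift l x) = shift (k + l) x"
  by (simp add: shift_def algebra_simps)

lemma shift_eq_iff: "shift k x = shift l y \<longleftrightarrow> x = shift (l - k) y"
  by (auto simp: shift_def prod_eq_iff algebra_simps)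

lemma inj_shift: "inj (shift k)"
  by (rule injI) (simp add: shift_eq_iff)

lemma continuous_on_shift [continuous_intros]:
  "continuous_on S f \<Longrightarrow> continuous_on S (\<lambda>x. shift k (f x))"
  unfolding shift_def by (intro continuous_intros)

lemma shift_strip [simp]: "shift k x \<in> strip \<longleftrightarrow> x \<in> strip"
  by (auto simp: strip_def mem_Times_iff)

lemma image_shift_strip [simp]: "shift k ` strip = strip"
proof
  show "strip \<subseteq> shift k ` strip"
    by (rule subsetI) (rule_tac x = "shift (-k) x" in image_eqI, auto)
qed auto

lemma cyl_cover_eq_iff: "cyl_cover x = cyl_cover y \<longleftrightarrow> (\<exists>k. y = shift k x)"
proof -
  have "cyl_cover x = cyl_cover y \<longleftrightarrow> (sin (fst y) = sin (fst x) \<and> cos (fst y) = cos (fst x)) \<and> snd x = snd y"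
    by (auto simp: cyl_cover_def complex_eq_iff)
  then show ?thesis
    unfolding sin_cos_eq_iff by (auto simp: shift_def prod_eq_iff)
qed

lemma cyl_cover_shift [simp]: "cyl_cover (shift k x) = cyl_cover x"
  by (metis cyl_cover_eq_iff)

lemma is_lift_shift: "is_lift g gt \<Longrightarrow> is_lift g (shift k \<circ> gt)"
  by (auto simp: is_lift_def path_def intro!: continuous_intros simp: o_def)

text \<open>A lift is the imaginary part of a continuous logarithm of the first component.\<close>

lemma lift_exists:
  assumes "path g" "path_image g \<subseteq> cylinder" "cyl_cover x = g 0"
  obtains gt where "is_lift g gt" "gt 0 = x"
proof -
  have sph: "fst (g t) \<in> sphere 0 1" if "t \<in> {0..1}" for t
    using assms(2) that by (force simp: path_image_def cylinder_def mem_Times_iff)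
  obtain l where l: "continuous_on {0..1} l" "\<And>t. t \<in> {0..1} \<Longrightarrow> fst (g t) = exp (l t)"
  proof (rule continuous_logarithm_on_contractible[of "{0..1::real}" "\<lambda>t. fst (g t)"])
    show "continuous_on {0..1} (\<lambda>t. fst (g t))"
      using assms(1) by (auto simp: path_def intro!: continuous_intros)
    show "fst (g t) \<noteq> 0" if "t \<in> {0..1}" for t using sph[OF that] by auto
  qed (auto simp: convex_imp_contractible)
  have cis: "cis (Im (l t)) = fst (g t)" if "t \<in> {0..1}" for t
  proof -
    have "norm (exp (l t)) = 1" using sph[OF that] l(2)[OF that] by simp
    then have "Re (l t) = 0" by simp
    then show ?thesis using l(2)[OF that] by (simp add: exp_eq_polar)
  qed
  define gt where "gt t = (Im (l t), snd (g t))" for t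
  have lift: "is_lift g gt"
    unfolding is_lift_def
  proof
    show "path gt"
      using l(1) assms(1) unfolding path_def gt_def by (intro continuous_intros)
    show "\<forall>t\<in>{0..1}. cyl_cover (gt t) = g t"
      using cis by (auto simp: cyl_cover_def gt_def)
  qed
  then have "cyl_cover (gt 0) = cyl_cover x" using assms(3) by (simp add: is_lift_def)
  then obtain k where "x = shift k (gt 0)" by (auto simp: cyl_cover_eq_iff)
  then show thesis using is_lift_shift[OF lift, of k] that by simp
qed

text \<open>The difference of two lifts, measured in full turns, is continuous and integer-valued.\<close>

lemma lift_unique:
  assumes "is_lift g gt" "is_lift g gt'"
  obtains k where "\<And>t. t \<in> {0..1} \<Longrightarrow> gt' t = shift k (gt t)"
proof -
  define d where "d t = (fst (gt' t) - fst (gt t)) / (2 * pi)" for t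
  have k: "\<exists>k. gt' t = shift k (gt t)" if "t \<in> {0..1}" for t
    using assms that by (auto simp: is_lift_def simp flip: cyl_cover_eq_iff)
  have dk: "\<exists>k. d t = of_int k \<and> gt' t = shift k (gt t)" if "t \<in> {0..1}" for t
    using k[OF that] by (auto simp: d_def)
  have "d constant_on {0..1}"
  proof (rule continuous_discrete_range_constant)
    show "continuous_on {0..1} d"
      unfolding d_def using assms by (auto simp: is_lift_def path_def intro!: continuous_intros)
    fix t :: real assume t: "t \<in> {0..1}"
    show "\<exists>e>0. \<forall>y. y \<in> {0..1} \<and> d y \<noteq> d t \<longrightarrow> e \<le> norm (d y - d t)"
    proof (intro exI[of _ 1] conjI allI impI)
      fix y assume y: "y \<in> {0..1} \<and> d y \<noteq> d t"
      obtain k l where "d y = of_int k" "d t = of_int l" using dk[of y] dk[of t] y t by auto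
      then show "1 \<le> norm (d y - d t)" using y by auto
    qed auto
  qed auto
  then obtain c where c: "\<And>t. t \<in> {0..1} \<Longrightarrow> d t = c" by (auto simp: constant_on_def)
  obtain k0 where "d 0 = of_int k0" using dk[of 0] by auto
  then have "gt' t = shift k0 (gt t)" if "t \<in> {0..1}" for t
    using dk[OF that] c[OF that] c[of 0] by auto
  then show thesis using that by blast
qed

lemma lift_in_strip:
  assumes "is_lift g gt" "path_image g \<subseteq> cylinder"
  shows "path_image gt \<subseteq> strip"
proof
  fix x assume "x \<in> path_image gt"
  then obtain t where t: "t \<in> {0..1}" "x = gt t" by (auto simp: path_image_def)
  then have "cyl_cover x \<in> cylinder"
    using assms by (force simp: is_lift_def path_image_def)
  then show "x \<in> strip" by (auto simp: cyl_cover_def cylinder_def strip_def mem_Times_iff)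
qed

lemma path_image_shift: "path_image (shift k \<circ> h) = shift k ` path_image h"
  by (rule path_image_compose)

lemma side_shift:
  assumes "path_image h' = shift k ` path_image h"
  shows "shift k x \<in> cw_side h' \<longleftrightarrow> x \<in> cw_side h" "shift k x \<in> ccw_side h' \<longleftrightarrow> x \<in> ccw_side h"
proof -
  have step: "connected_component (strip - shift k ` S) (shift k x) (shift k y)"
    if conn: "connected_component (strip - S) x y" for k x y and S :: "(real \<times> real) set"
  proof -
    obtain T where T: "topological_space_class.connected T" "T \<subseteq> strip - S" "x \<in> T" "y \<in> T"
      using conn unfolding connected_component_def by blast
    show ?thesis
    proof (rule connected_componentI)
      show "topological_space_class.connected (shift k ` T)"
        using T(1) by (intro connected_continuous_image continuous_intros)
      have "shift k ` T \<subseteq> shift k ` (strip - S)" using T(2) by blast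
      also have "\<dots> = strip - shift k ` S" by (simp add: image_set_diff[OF inj_shift])
      finally show "shift k ` T \<subseteq> strip - shift k ` S" .
    qed (use T in auto)
  qed
  have iff: "connected_component (strip - path_image h') (shift k x) (shift k y) \<longleftrightarrow>
      connected_component (strip - path_image h) x y" for x y
  proof
    assume "connected_component (strip - path_image h') (shift k x) (shift k y)"
    from step[OF this, of "-k"] show "connected_component (strip - path_image h) x y"
      by (simp add: assms image_image)
  qed (simp add: assms step)
  have bound: "(\<exists>M. \<forall>y\<in>strip. fst y < M \<longrightarrow> Q y) \<longleftrightarrow> (\<exists>M. \<forall>y\<in>strip. fst y < M \<longrightarrow> Q (shift k y))"
    "(\<exists>M. \<forall>y\<in>strip. fst y > M \<longrightarrow> Q y) \<longleftrightarrow> (\<exists>M. \<forall>y\<in>strip. fst y > M \<longrightarrow> Q (shift k y))" for Q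
  proof -
    let ?c = "2 * pi * of_int k :: real"
    show "(\<exists>M. \<forall>y\<in>strip. fst y < M \<longrightarrow> Q y) \<longleftrightarrow> (\<exists>M. \<forall>y\<in>strip. fst y < M \<longrightarrow> Q (shift k y))"
    proof safe
      fix M assume "\<forall>y\<in>strip. fst y < M \<longrightarrow> Q y"
      then show "\<exists>M. \<forall>y\<in>strip. fst y < M \<longrightarrow> Q (shift k y)" by (intro exI[of _ "M - ?c"]) auto
    next
      fix M assume *: "\<forall>y\<in>strip. fst y < M \<longrightarrow> Q (shift k y)"
      have "Q y" if "y \<in> strip" "fst y < M + ?c" for y
        using bspec[OF *, of "shift (- k) y"] that by simp
      then show "\<exists>M. \<forall>y\<in>strip. fst y < M \<longrightarrow> Q y" by blast
    qed
    show "(\<exists>M. \<forall>y\<in>strip. fst y > M \<longrightarrow> Q y) \<longleftrightarrow> (\<exists>M. \<forall>y\<in>strip. fst y > M \<longrightarrow> Q (shift k y))"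
    proof safe
      fix M assume "\<forall>y\<in>strip. fst y > M \<longrightarrow> Q y"
      then show "\<exists>M. \<forall>y\<in>strip. fst y > M \<longrightarrow> Q (shift k y)" by (intro exI[of _ "M - ?c"]) auto
    next
      fix M assume *: "\<forall>y\<in>strip. fst y > M \<longrightarrow> Q (shift k y)"
      have "Q y" if "y \<in> strip" "fst y > M + ?c" for y
        using bspec[OF *, of "shift (- k) y"] that by simp
      then show "\<exists>M. \<forall>y\<in>strip. fst y > M \<longrightarrow> Q y" by blast
    qed
  qed
  show "shift k x \<in> cw_side h' \<longleftrightarrow> x \<in> cw_side h" "shift k x \<in> ccw_side h' \<longleftrightarrow> x \<in> ccw_side h"
    unfolding cw_side_def ccw_side_def mem_Collect_eq by (subst bound, simp only: iff)+
qed

section \<open>Levels between the translates of a chord\<close>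

text \<open>The chord is an arc on the cylinder, so its different lifts are disjoint.\<close>

locale periodic_chord = strip_chord +
  assumes translates_disjoint: "x \<in> path_image h \<Longrightarrow> shift k x \<in> path_image h \<Longrightarrow> k = 0"
begin

abbreviation translate :: "int \<Rightarrow> real \<Rightarrow> real \<times> real" where
  "translate k \<equiv> shift k \<circ> h"

lemma translate_strip_chord: "strip_chord (translate k) (a + 2 * pi * of_int k) (b + 2 * pi * of_int k)"
proof
  show "arc (translate k)"
    unfolding arc_def
  proof
    show "path (translate k)"
      using arc_imp_path[OF arc_h] by (auto simp: path_def o_def intro!: continuous_intros)
    show "inj_on (translate k) {0..1}"
      using arc_h inj_shift by (metis arc_def comp_inj_on inj_on_subset subset_UNIV)
  qed
qed (use h_start h_finish h_interior in \<open>auto simp: pathstart_def pathfinish_def shift_def\<close>)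

lemma translate_disjoint:
  assumes "x \<in> path_image (translate k)" "x \<in> path_image (translate l)"
  shows "k = l"
proof -
  obtain y z where "y \<in> path_image h" "x = shift k y" "z \<in> path_image h" "x = shift l z"
    using assms by (auto simp: path_image_shift)
  moreover from this have "y = shift (l - k) z" by (simp add: shift_eq_iff)
  ultimately show ?thesis using translates_disjoint[of z "l - k"] by simp
qed

text \<open>The level counts the translates of the chord that have been passed, in the sense that \<open>x\<close> is on
their counterclockwise side, relative to the situation just right of the chord \<open>h\<close> itself,
which has level \<open>0\<close>. Far translates do not contribute, see \<open>far_sides\<close>.\<close>

definition level :: "real \<times> real \<Rightarrow> int" where
  "level x = int (card {k. 0 < k \<and> x \<in> ccw_side (translate k)})
           - int (card {k. k \<le> 0 \<and> x \<notin> ccw_side (translate k)})"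

lemma level_eqI:
  assumes "\<And>k. x \<in> ccw_side (translate k) \<longleftrightarrow> k \<le> m"
  shows "level x = m"
proof -
  have "{k. 0 < k \<and> x \<in> ccw_side (translate k)} = {0<..m}" "{k. k \<le> 0 \<and> x \<notin> ccw_side (translate k)} = {m<..0}"
    by (auto simp only: assms greaterThanAtMost_iff mem_Collect_eq not_le)
  then show ?thesis unfolding level_def by simp
qed

lemma level_bottom:
  assumes "a + 2 * pi * of_int m < x" "x < a + 2 * pi * (of_int m + 1)"
  shows "level (x, 0) = m"
proof (rule level_eqI)
  fix k
  interpret T: strip_chord "translate k" "a + 2 * pi * of_int k" "b + 2 * pi * of_int k"
    by (rule translate_strip_chord)
  show "(x, 0) \<in> ccw_side (translate k) \<longleftrightarrow> k \<le> m"
  proof (cases "k \<le> m")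
    case True
    then have "2 * pi * of_int k \<le> 2 * pi * of_int m" by (intro mult_left_mono) auto
    then have "a + 2 * pi * of_int k < x" using assms(1) by linarith
    then show ?thesis using T.bottom_sides(2)[of x] True by simp
  next
    case False
    then have "real_of_int m + 1 \<le> of_int k" by linarith
    from mult_left_mono[OF this, of "2 * pi"] have "2 * pi * (of_int m + 1) \<le> 2 * pi * of_int k" by simp
    then have "x < a + 2 * pi * of_int k" using assms(2) by linarith
    then show ?thesis using T.bottom_sides(1)[of x] False T.sides_disjoint by blast
  qed
qed

lemma level_top:
  assumes "b + 2 * pi * of_int m < x" "x < b + 2 * pi * (of_int m + 1)"
  shows "level (x, 1) = m"
proof (rule level_eqI)
  fix k
  interpret T: strip_chord "translate k" "a + 2 * pi * of_int k" "b + 2 * pi * of_int k"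
    by (rule translate_strip_chord)
  show "(x, 1) \<in> ccw_side (translate k) \<longleftrightarrow> k \<le> m"
  proof (cases "k \<le> m")
    case True
    then have "2 * pi * of_int k \<le> 2 * pi * of_int m" by (intro mult_left_mono) auto
    then have "b + 2 * pi * of_int k < x" using assms(1) by linarith
    then show ?thesis using T.top_sides(2)[of x] True by simp
  next
    case False
    then have "real_of_int m + 1 \<le> of_int k" by linarith
    from mult_left_mono[OF this, of "2 * pi"] have "2 * pi * (of_int m + 1) \<le> 2 * pi * of_int k" by simp
    then have "x < b + 2 * pi * of_int k" using assms(2) by linarith
    then show ?thesis using T.top_sides(1)[of x] False T.sides_disjoint by blast
  qed
qed

lemma far_sides:
  obtains M :: int where "0 \<le> M"
    "\<And>x k. x \<in> strip \<Longrightarrow> \<bar>fst x\<bar> \<le> R \<Longrightarrow> M < k \<Longrightarrow> x \<in> cw_side (translate k)"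
    "\<And>x k. x \<in> strip \<Longrightarrow> \<bar>fst x\<bar> \<le> R \<Longrightarrow> k < - M \<Longrightarrow> x \<in> ccw_side (translate k)"
proof -
  obtain B where B: "\<And>x. x \<in> path_image h \<Longrightarrow> \<bar>fst x\<bar> \<le> B" using h_bounded by blast
  define M where "M = \<lceil>\<bar>B\<bar> + \<bar>R\<bar>\<rceil>"
  have M: "\<bar>B\<bar> + \<bar>R\<bar> < 2 * pi * of_int k" if "M < k" for k
  proof -
    have "\<bar>B\<bar> + \<bar>R\<bar> < of_int k" using that unfolding M_def by (simp add: ceiling_less_iff)
    also have "\<dots> \<le> 2 * pi * of_int k"
    proof -
      have "0 \<le> M" by (simp add: M_def)
      then show ?thesis using that pi_gt3 mult_right_mono[of 1 "2 * pi" "of_int k"] by simp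
    qed
    finally show ?thesis .
  qed
  show thesis
  proof (rule that[of M])
    show "0 \<le> M" unfolding M_def by simp
  next
    fix x k assume x: "x \<in> strip" "\<bar>fst x\<bar> \<le> R" "M < k"
    interpret T: strip_chord "translate k" "a + 2 * pi * of_int k" "b + 2 * pi * of_int k"
      by (rule translate_strip_chord)
    show "x \<in> cw_side (translate k)"
    proof (rule T.cw_sideI[of "2 * pi * of_int k - B"])
      show "2 * pi * of_int k - B \<le> fst y" if "y \<in> path_image (translate k)" for y
        using that B by (fastforce simp: path_image_shift)
    qed (use x M[of k] in auto)
  next
    fix x k assume x: "x \<in> strip" "\<bar>fst x\<bar> \<le> R" "k < - M"
    interpret T: strip_chord "translate k" "a + 2 * pi * of_int k" "b + 2 * pi * of_int k"
      by (rule translate_strip_chord)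
    show "x \<in> ccw_side (translate k)"
    proof (rule T.ccw_sideI[of "2 * pi * of_int k + B"])
      show "fst y \<le> 2 * pi * of_int k + B" if "y \<in> path_image (translate k)" for y
        using that B by (fastforce simp: path_image_shift)
    qed (use x M[of "- k"] in auto)
  qed
qed

text \<open>Over a sufficiently large window the level is a plain sum up to a constant, so differences of
levels can be computed translate by translate.\<close>

lemma level_bounded_sum:
  assumes "0 \<le> M" "\<And>k. M < k \<Longrightarrow> x \<notin> ccw_side (translate k)" "\<And>k. k < - M \<Longrightarrow> x \<in> ccw_side (translate k)"
  shows "level x = (\<Sum>k\<in>{-M..M}. of_bool (x \<in> ccw_side (translate k))) - (M + 1)"
proof -
  let ?p = "\<lambda>k. x \<in> ccw_side (translate k)"
  have 1: "{k. 0 < k \<and> ?p k} = {k\<in>{0<..M}. ?p k}" using assms(2) by force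
  have 2: "{k. k \<le> 0 \<and> \<not> ?p k} = {k\<in>{-M..0}. \<not> ?p k}" using assms(3) by force
  have c: "int (card {k\<in>A. Q k}) = (\<Sum>k\<in>A. of_bool (Q k))" if "finite A" for A :: "int set" and Q
    using that by (simp add: of_bool_def sum.If_cases Int_def)
  have "{-M..M} = {-M..0} \<union> {0<..M}" using assms(1) by auto
  then have "(\<Sum>k\<in>{-M..M}. of_bool (?p k)) = (\<Sum>k\<in>{-M..0}. of_bool (?p k)) + (\<Sum>k\<in>{0<..M}. of_bool (?p k) :: int)"
    by (simp only:) (rule sum.union_disjoint, auto)
  moreover have "(\<Sum>k\<in>{-M..0}. of_bool (\<not> ?p k) :: int) = (M + 1) - (\<Sum>k\<in>{-M..0}. of_bool (?p k))"
    using assms(1) by (simp add: of_bool_not_iff sum_subtractf)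
  ultimately show ?thesis
    unfolding level_def 1 2 using c[of "{0<..M}" ?p] c[of "{-M..0}" "\<lambda>k. \<not> ?p k"] by simp
qed

text \<open>For each translate of the chord, the signed number of crossings is the change of the side, by
\<open>count_changes\<close>. The crossings of \<open>g\<close> with the chord are the crossings of the one lift \<open>gt\<close> with all
translates, since any other pair of lifts can be moved by a deck transformation such that \<open>g\<close> is
lifted by \<open>gt\<close>. At each time \<open>gt\<close> is on at most one translate, so summing over the translates counts
every crossing once and turns changes of sides into the change of level.\<close>

lemma lift_level:
  assumes hc: "is_lift hc h" and g: "is_lift g gt" "path_image g \<subseteq> cylinder"
    and fin: "finite {t\<in>{0..1}. g t \<in> path_image hc}"
    and ends: "g 0 \<notin> path_image hc" "g 1 \<notin> path_image hc"
  shows "level (gt 1) = level (gt 0) + curve_rotor hc g"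
proof -
  have strip: "gt t \<in> strip" if "t \<in> {0..1}" for t
    using lift_in_strip[OF g] that by (auto simp: path_image_def)
  have path_gt: "continuous_on {0..1} gt" using g(1) by (simp add: is_lift_def path_def)
  obtain R where R: "\<And>t. t \<in> {0..1} \<Longrightarrow> \<bar>fst (gt t)\<bar> \<le> R"
  proof -
    have "bounded ((\<lambda>t. fst (gt t)) ` {0..1})"
      by (intro compact_imp_bounded compact_continuous_image continuous_intros path_gt) auto
    then show thesis using that unfolding bounded_iff by (metis imageI real_norm_def)
  qed
  obtain M where M: "0 \<le> M"
    "\<And>t k. t \<in> {0..1} \<Longrightarrow> M < k \<Longrightarrow> gt t \<in> cw_side (translate k)"
    "\<And>t k. t \<in> {0..1} \<Longrightarrow> k < - M \<Longrightarrow> gt t \<in> ccw_side (translate k)"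
    using far_sides[of R] R strip by metis
  define F where "F k = {t\<in>{0..1}. gt t \<in> path_image (translate k)}" for k
  have on_chord: "g t \<in> path_image hc" if t: "t \<in> {0..1}" "gt t \<in> path_image (translate k)" for t k
  proof -
    obtain s where s: "s \<in> {0..1}" "gt t = shift k (h s)"
      using t(2) by (auto simp: path_image_def)
    then have "g t = hc s" using g(1) hc t(1) by (metis is_lift_def cyl_cover_shift)
    then show ?thesis using s(1) by (simp add: path_image_def)
  qed
  have finF: "finite (F k)" for k
    by (rule finite_subset[OF _ fin]) (auto simp: F_def on_chord)
  have F01: "F k \<subseteq> {0<..<1}" for k
  proof
    fix t assume t: "t \<in> F k"
    then have "g t \<in> path_image hc" "t \<in> {0..1}" by (auto simp: F_def intro: on_chord)
    moreover from this have "t \<noteq> 0" "t \<noteq> 1" using ends by auto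
    ultimately show "t \<in> {0<..<1}" by auto
  qed
  let ?cw = "\<lambda>k s. gt s \<in> cw_side (translate k)" and ?ccw = "\<lambda>k s. gt s \<in> ccw_side (translate k)"
  define U where "U k = {t\<in>F k. (\<forall>\<^sub>F s in at_left t. ?cw k s) \<and> (\<forall>\<^sub>F s in at_right t. ?ccw k s)}" for k
  define D where "D k = {t\<in>F k. (\<forall>\<^sub>F s in at_left t. ?ccw k s) \<and> (\<forall>\<^sub>F s in at_right t. ?cw k s)}" for k
  \<comment> \<open>Off the translate, a point is on the clockwise side iff it is not on the counterclockwise side.\<close>
  have jump: "int (card (U k)) - int (card (D k)) = of_bool (?ccw k 1) - of_bool (?ccw k 0)" for k
  proof -
    interpret T: strip_chord "translate k" "a + 2 * pi * of_int k" "b + 2 * pi * of_int k"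
      by (rule translate_strip_chord)
    have cw_iff: "?cw k s \<longleftrightarrow> \<not> ?ccw k s" if "s \<in> {0..1} - F k" for s
      using that strip[of s] T.sides_cover T.sides_disjoint by (auto simp: F_def)
    have near: "\<forall>\<^sub>F s in at_left t. s \<in> {0..1} - F k" "\<forall>\<^sub>F s in at_right t. s \<in> {0..1} - F k" if "t \<in> F k" for t
    proof -
      have t: "0 < t" "t < 1" using that F01 by force+
      have "open (- (F k - {t}))" by (intro open_Compl finite_imp_closed finite_Diff finF)
      then have "\<forall>\<^sub>F s in nhds t. s \<in> - (F k - {t})"
        by (intro eventually_nhds_in_open) auto
      then have "\<forall>\<^sub>F s in at t. s \<in> - F k"
        unfolding eventually_at_filter by (auto elim: eventually_mono)
      then have "\<forall>\<^sub>F s in at_left t. s \<notin> F k" "\<forall>\<^sub>F s in at_right t. s \<notin> F k"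
        by (auto simp: eventually_at_split)
      moreover have "\<forall>\<^sub>F s in at_left t. s \<in> {0<..<t}" "\<forall>\<^sub>F s in at_right t. s \<in> {t<..<1}"
        using t eventually_at_left_real eventually_at_right_real by blast+
      ultimately have "\<forall>\<^sub>F s in at_left t. s \<notin> F k \<and> s \<in> {0<..<t}"
        "\<forall>\<^sub>F s in at_right t. s \<notin> F k \<and> s \<in> {t<..<1}"
        by (simp_all add: eventually_conj_iff)
      then show "\<forall>\<^sub>F s in at_left t. s \<in> {0..1} - F k" "\<forall>\<^sub>F s in at_right t. s \<in> {0..1} - F k"
        using t by (auto elim!: eventually_mono)
    qed
    have ev: "(\<forall>\<^sub>F s in G. ?cw k s) \<longleftrightarrow> (\<forall>\<^sub>F s in G. \<not> ?ccw k s)"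
      if "\<forall>\<^sub>F s in G. s \<in> {0..1} - F k" for G
      using that by (intro eventually_subst) (auto elim!: eventually_mono simp: cw_iff)
    have UD: "U k = {t\<in>F k. (\<forall>\<^sub>F s in at_left t. \<not> ?ccw k s) \<and> (\<forall>\<^sub>F s in at_right t. ?ccw k s)}"
      "D k = {t\<in>F k. (\<forall>\<^sub>F s in at_left t. ?ccw k s) \<and> (\<forall>\<^sub>F s in at_right t. \<not> ?ccw k s)}"
      unfolding U_def D_def using ev near by blast+
    show ?thesis
      unfolding UD
    proof (rule count_changes[OF finF F01])
      fix x y :: real assume xy: "0 \<le> x" "x \<le> y" "y \<le> 1" "{x..y} \<inter> F k = {}"
      show "?ccw k x = ?ccw k y"
      proof (rule T.side_connected_set(2))
        show "topological_space_class.connected (gt ` {x..y})"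
          using xy by (intro connected_continuous_image continuous_on_subset[OF path_gt]) auto
        show "gt ` {x..y} \<subseteq> strip - path_image (translate k)"
          using xy strip by (force simp: F_def)
      qed (use xy in auto)
    qed simp
  qed
  \<comment> \<open>Any two lifts of the curve and the chord are related like \<open>gt\<close> and some translate.\<close>
  have lifts: "\<exists>k. \<forall>s\<in>{0..1}. (gt' s \<in> path_image ht' \<longleftrightarrow> gt s \<in> path_image (translate k)) \<and>
      (gt' s \<in> cw_side ht' \<longleftrightarrow> ?cw k s) \<and> (gt' s \<in> ccw_side ht' \<longleftrightarrow> ?ccw k s)"
    if lift: "is_lift g gt'" "is_lift hc ht'" for gt' ht'
  proof -
    obtain m where m: "\<And>t. t \<in> {0..1} \<Longrightarrow> gt t = shift m (gt' t)"
      using lift_unique[OF lift(1) g(1)] by blast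
    obtain l where l: "\<And>t. t \<in> {0..1} \<Longrightarrow> ht' t = shift l (h t)"
      using lift_unique[OF hc lift(2)] by blast
    have "path_image (translate (m + l)) = shift m ` path_image ht'"
      using l by (force simp: path_image_def image_iff)
    then show ?thesis
      using m side_shift[of "translate (m + l)" m ht'] inj_shift
      by (intro exI[of _ "m + l"]) (auto simp: inj_image_mem_iff)
  qed
  have inside: "\<forall>\<^sub>F s in at_left t. s \<in> {0..1}" "\<forall>\<^sub>F s in at_right t. s \<in> {0..1}" if "t \<in> {0<..<1}" for t :: real
  proof -
    have "\<forall>\<^sub>F s in at_left t. s \<in> {0<..<t}" "\<forall>\<^sub>F s in at_right t. s \<in> {t<..<1}"
      using that eventually_at_left_real eventually_at_right_real by auto
    then show "\<forall>\<^sub>F s in at_left t. s \<in> {0..1}" "\<forall>\<^sub>F s in at_right t. s \<in> {0..1}"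
      using that by (auto elim!: eventually_mono)
  qed
  have translate_lift: "is_lift hc (translate k)" for k by (rule is_lift_shift[OF hc])
  have small: "k \<in> {-M..M}" if "t \<in> F k" for t k
  proof -
    interpret T: strip_chord "translate k" "a + 2 * pi * of_int k" "b + 2 * pi * of_int k"
      by (rule translate_strip_chord)
    have "\<not> M < k" "\<not> k < - M"
      using that M(2)[of t k] M(3)[of t k] T.side_subset by (auto simp: F_def)
    then show ?thesis by simp
  qed
  have UU: "{t\<in>{0<..<1}. crosses_ccw_at hc g t} = (\<Union>k\<in>{-M..M}. U k)"
  proof safe
    fix t :: real assume t: "t \<in> {0<..<1}" and "crosses_ccw_at hc g t"
    then obtain gt' ht' where lift: "is_lift g gt'" "is_lift hc ht'" and c: "gt' t \<in> path_image ht'"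
      "\<forall>\<^sub>F s in at_left t. gt' s \<in> cw_side ht'" "\<forall>\<^sub>F s in at_right t. gt' s \<in> ccw_side ht'"
      by (auto simp: crosses_ccw_at_def)
    obtain k where k: "\<forall>s\<in>{0..1}. (gt' s \<in> path_image ht' \<longleftrightarrow> gt s \<in> path_image (translate k)) \<and>
      (gt' s \<in> cw_side ht' \<longleftrightarrow> ?cw k s) \<and> (gt' s \<in> ccw_side ht' \<longleftrightarrow> ?ccw k s)"
      using lifts[OF lift] by blast
    have "t \<in> F k" using k c(1) t by (auto simp: F_def)
    moreover have "\<forall>\<^sub>F s in at_left t. ?cw k s"
      using c(2) inside(1)[OF t] by eventually_elim (use k in blast)
    moreover have "\<forall>\<^sub>F s in at_right t. ?ccw k s"
      using c(3) inside(2)[OF t] by eventually_elim (use k in blast)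
    ultimately have "t \<in> U k" by (simp add: U_def)
    then show "t \<in> (\<Union>k\<in>{-M..M}. U k)" using small[OF \<open>t \<in> F k\<close>] by blast
  next
    fix t k assume "t \<in> U k"
    then show "crosses_ccw_at hc g t"
      unfolding crosses_ccw_at_def U_def F_def using g(1) translate_lift[of k] by blast
  qed (use F01 in \<open>fastforce simp: U_def\<close>)+
  have DD: "{t\<in>{0<..<1}. crosses_cw_at hc g t} = (\<Union>k\<in>{-M..M}. D k)"
  proof safe
    fix t :: real assume t: "t \<in> {0<..<1}" and "crosses_cw_at hc g t"
    then obtain gt' ht' where lift: "is_lift g gt'" "is_lift hc ht'" and c: "gt' t \<in> path_image ht'"
      "\<forall>\<^sub>F s in at_left t. gt' s \<in> ccw_side ht'" "\<forall>\<^sub>F s in at_right t. gt' s \<in> cw_side ht'"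
      by (auto simp: crosses_cw_at_def)
    obtain k where k: "\<forall>s\<in>{0..1}. (gt' s \<in> path_image ht' \<longleftrightarrow> gt s \<in> path_image (translate k)) \<and>
      (gt' s \<in> cw_side ht' \<longleftrightarrow> ?cw k s) \<and> (gt' s \<in> ccw_side ht' \<longleftrightarrow> ?ccw k s)"
      using lifts[OF lift] by blast
    have "t \<in> F k" using k c(1) t by (auto simp: F_def)
    moreover have "\<forall>\<^sub>F s in at_left t. ?ccw k s"
      using c(2) inside(1)[OF t] by eventually_elim (use k in blast)
    moreover have "\<forall>\<^sub>F s in at_right t. ?cw k s"
      using c(3) inside(2)[OF t] by eventually_elim (use k in blast)
    ultimately have "t \<in> D k" by (simp add: D_def)
    then show "t \<in> (\<Union>k\<in>{-M..M}. D k)" using small[OF \<open>t \<in> F k\<close>] by blast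
  next
    fix t k assume "t \<in> D k"
    then show "crosses_cw_at hc g t"
      unfolding crosses_cw_at_def D_def F_def using g(1) translate_lift[of k] by blast
  qed (use F01 in \<open>fastforce simp: D_def\<close>)+
  have disj: "F k \<inter> F l = {}" if "k \<noteq> l" for k l
    using that translate_disjoint unfolding F_def by blast
  have sub: "U k \<subseteq> F k" "D k \<subseteq> F k" for k by (auto simp: U_def D_def)
  have card: "card (\<Union>k\<in>{-M..M}. A k) = (\<Sum>k\<in>{-M..M}. card (A k))" if "\<And>k. A k \<subseteq> F k" for A
  proof (rule card_UN_disjoint)
    show "\<forall>k\<in>{-M..M}. finite (A k)" using that finF finite_subset by blast
    show "\<forall>k\<in>{-M..M}. \<forall>l\<in>{-M..M}. k \<noteq> l \<longrightarrow> A k \<inter> A l = {}" using that disj by blast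
  qed simp
  have "curve_rotor hc g = (\<Sum>k\<in>{-M..M}. int (card (U k)) - int (card (D k)))"
    unfolding curve_rotor_def UU DD card[of U, OF sub(1)] card[of D, OF sub(2)]
    by (simp add: sum_subtractf)
  also have "\<dots> = (\<Sum>k\<in>{-M..M}. of_bool (?ccw k 1)) - (\<Sum>k\<in>{-M..M}. of_bool (?ccw k 0))"
    unfolding jump by (rule sum_subtractf)
  also have "\<dots> = level (gt 1) - level (gt 0)"
  proof -
    have "?cw k t \<Longrightarrow> \<not> ?ccw k t" for k t
      using strip_chord.sides_disjoint[OF translate_strip_chord, of k] by blast
    then have "level (gt t) = (\<Sum>k\<in>{-M..M}. of_bool (?ccw k t)) - (M + 1)" if "t \<in> {0..1}" for t
      using M that by (intro level_bounded_sum) auto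
    from this[of 0] this[of 1] show ?thesis by simp
  qed
  finally show ?thesis by simp
qed

end

section \<open>Normalized source and sink positions\<close>

lemma residue_rep_bounds: "n \<ge> 1 \<Longrightarrow> residue_rep n i \<in> {1..n}"
proof -
  assume "n \<ge> 1"
  then have "0 \<le> (i - 1) mod int n" "(i - 1) mod int n < int n" by simp_all
  then show ?thesis by (auto simp: residue_rep_def)
qed

lemma residue_rep_alpha: "n \<ge> 1 \<Longrightarrow> i = int (residue_rep n i) + int n * alpha n i"
proof -
  assume n: "n \<ge> 1"
  then have "0 \<le> (i - 1) mod int n" by simp
  then have r: "int (residue_rep n i) = (i - 1) mod int n + 1" by (simp add: residue_rep_def)
  have "i - int (residue_rep n i) = int n * ((i - 1) div int n)"
    unfolding r using div_mult_mod_eq[of "i - 1" "int n"] by (simp add: algebra_simps)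
  then show ?thesis using n by (simp add: alpha_def)
qed

lemma residue_alpha_less:
  assumes "n \<ge> 1" "i < i'"
  shows "alpha n i < alpha n i' \<or> alpha n i = alpha n i' \<and> residue_rep n i < residue_rep n i'"
proof (rule ccontr)
  assume *: "\<not> ?thesis"
  have b: "residue_rep n i \<in> {1..n}" "residue_rep n i' \<in> {1..n}"
    using residue_rep_bounds assms(1) by blast+
  show False
  proof (cases "alpha n i = alpha n i'")
    case True
    then show False using * assms residue_rep_alpha[of n i] residue_rep_alpha[of n i'] by simp
  next
    case False
    then have "alpha n i' + 1 \<le> alpha n i" using * by simp
    then have "int n * (alpha n i' + 1) \<le> int n * alpha n i" by (intro mult_left_mono) auto
    then show False
      using b assms residue_rep_alpha[of n i] residue_rep_alpha[of n i'] by (simp add: algebra_simps)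
  qed
qed

text \<open>The condition on the end of the chord says that, seen counterclockwise from \<open>a\<close>, the points
\<open>z 1, \<dots>, z n\<close> come in this order within one turn. The arc from \<open>z n\<close> to \<open>z 1\<close> spans, in terms of given
angles \<open>\<theta>0\<close> of the points, exactly the interval from \<open>\<theta>0 n\<close> to \<open>\<theta>0 1 + 2 * pi\<close> up to full turns.\<close>

lemma ccw_window:
  assumes ord: "ccw_ordered n z" and n: "n \<ge> 1" and c: "cis a \<in> ccw_arc (z n) (z 1)"
  obtains \<theta> where "\<And>i. i \<in> {1..n} \<Longrightarrow> z i = cis (\<theta> i)" "strict_mono_on {1..n} \<theta>"
    "\<And>i. i \<in> {1..n} \<Longrightarrow> a < \<theta> i" "\<And>i. i \<in> {1..n} \<Longrightarrow> \<theta> i < a + 2 * pi"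
proof -
  have cis_eq: "\<exists>k::int. y = x + 2 * pi * of_int k" if "cis x = cis y" for x y
  proof -
    have "sin y = sin x \<and> cos y = cos x" using that by (simp add: complex_eq_iff)
    then show ?thesis unfolding sin_cos_eq_iff by blast
  qed
  have cis_add: "cis (x + 2 * pi * of_int k) = cis x" for x and k :: int
    using sin_cos_eq_iff[of "x + 2 * pi * of_int k" x] by (auto simp: complex_eq_iff)
  obtain \<theta>0 where \<theta>0: "\<And>i. i \<in> {1..n} \<Longrightarrow> z i = cis (\<theta>0 i)" "strict_mono_on {1..n} \<theta>0" "\<theta>0 n < \<theta>0 1 + 2 * pi"
    using ord unfolding ccw_ordered_def by blast
  obtain t s u where t: "cis a = cis t" "cis s = z n" "cis u = z 1" "s < t" "t < u" "u \<le> s + 2 * pi"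
    using c unfolding ccw_arc_def by blast
  obtain l where l: "s = \<theta>0 n + 2 * pi * of_int l" using cis_eq[of "\<theta>0 n" s] \<theta>0(1)[of n] t(2) n by auto
  obtain k where k: "u = \<theta>0 1 + 2 * pi * of_int k" using cis_eq[of "\<theta>0 1" u] \<theta>0(1)[of 1] t(3) n by auto
  obtain r where r: "a = t + 2 * pi * of_int r" using cis_eq[of t a] t(1) by auto
  have 1: "\<theta>0 1 \<le> \<theta>0 n"
    using strict_mono_onD[OF \<theta>0(2), of 1 n] n by (cases "n = 1") auto
  have "k = l + 1"
  proof -
    have "2 * pi * of_int l < 2 * pi * of_int k" using l k t 1 by linarith
    then have "l < k" by simp
    have "2 * pi * of_int k < 2 * pi * of_int l + 4 * pi" using l k t \<theta>0(3) by linarith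
    then have "2 * pi * of_int k < 2 * pi * of_int (l + 2)" by (simp add: algebra_simps)
    then have "real_of_int k < of_int (l + 2)" by (rule mult_left_less_imp_less) simp
    then have "k < l + 2" by simp
    with \<open>l < k\<close> have "k = l + 1" by simp
    then show ?thesis by simp
  qed
  define \<theta> where "\<theta> i = \<theta>0 i + 2 * pi * of_int (l + r + 1)" for i
  have ends: "a < \<theta> 1" "\<theta> n < a + 2 * pi"
    using l k t r \<open>k = l + 1\<close> by (simp_all add: \<theta>_def algebra_simps)
  have mono: "strict_mono_on {1..n} \<theta>"
    using \<theta>0(2) by (auto simp: strict_mono_on_def \<theta>_def)
  have le: "\<theta> 1 \<le> \<theta> i" "\<theta> i \<le> \<theta> n" if "i \<in> {1..n}" for i
    using strict_mono_onD[OF mono, of 1 i] strict_mono_onD[OF mono, of i n] that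
    by (cases "i = 1"; force simp: less_le)+
  show thesis
  proof (rule that)
    show "z i = cis (\<theta> i)" if "i \<in> {1..n}" for i
      using \<theta>0(1)[OF that] by (simp only: \<theta>_def cis_add)
    show "a < \<theta> i" "\<theta> i < a + 2 * pi" if "i \<in> {1..n}" for i
      using le[OF that] ends by auto
  qed (rule mono)
qed

section \<open>The lifted graph of a cylindric network\<close>

text \<open>The lifted graph as a transition system: the integer is the level of the lifted vertex.\<close>

definition cover_enabled :: "('v, 'e) cyl_network \<Rightarrow> 'v \<times> int \<Rightarrow> 'e \<Rightarrow> bool" where
  "cover_enabled N s e \<longleftrightarrow> e \<in> arcs (graph N) \<and> tail (graph N) e = fst s"

definition cover_step :: "('v, 'e) cyl_network \<Rightarrow> 'v \<times> int \<Rightarrow> 'e \<Rightarrow> 'v \<times> int" where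
  "cover_step N s e = (head (graph N) e, snd s + curve_rotor (chord N) (curve N e))"

context cylindric_network
begin

sublocale G: fin_digraph "graph N"
  by (rule fin_digraph_graph)

sublocale cover: transition_system "cover_enabled N" "cover_step N" .

lemma no_closed_walk: "G.awalk u p u \<Longrightarrow> p = []"
  using acyclic_graph G.reachable1_awalkI by (metis acyclic_def)

lemma awalk_rest: "G.awalk u (p @ q) v \<Longrightarrow> G.awalk u p c \<Longrightarrow> G.awalk c q v"
  using G.awlast_of_awalk by auto

lemma awalk_apath: "G.apath u p v \<longleftrightarrow> G.awalk u p v"
proof
  assume p: "G.awalk u p v"
  have "distinct (G.awalk_verts u p)"
  proof (rule ccontr)
    assume "\<not> distinct (G.awalk_verts u p)"
    then obtain r w where "0 < length r" "G.awalk w r w"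
      using G.awalk_not_distinct_decomp[OF p] by blast
    then show False using no_closed_walk by auto
  qed
  then show "G.apath u p v" using p by (simp add: G.apath_def)
qed (simp add: G.apath_def)

lemma run_iff_awalk:
  assumes "u \<in> verts (graph N)"
  shows "cover.run (u, k) p (v, l) \<longleftrightarrow> G.awalk u p v \<and> l = k + rotor N p"
  using assms
proof (induction p arbitrary: u k)
  case Nil
  then show ?case by (auto simp: G.awalk_Nil_iff rotor_def)
next
  case (Cons e p)
  have "cover.run (u, k) (e # p) (v, l) \<longleftrightarrow> e \<in> arcs (graph N) \<and> tail (graph N) e = u \<and>
      cover.run (head (graph N) e, k + curve_rotor (chord N) (curve N e)) p (v, l)"
    by (simp add: cover_enabled_def cover_step_def)
  also have "\<dots> \<longleftrightarrow> G.awalk u (e # p) v \<and> l = k + rotor N (e # p)"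
    using Cons.IH by (auto simp: G.awalk_Cons_iff rotor_def)
  finally show ?case .
qed

lemma visited_iff:
  assumes "G.awalk u p v"
  shows "(c, m) \<in> cover.visited (u, k) p \<longleftrightarrow>
    (\<exists>p1 p2. p = p1 @ p2 \<and> G.awalk u p1 c \<and> m = k + rotor N p1)"
proof
  have u: "u \<in> verts (graph N)" using assms by (rule G.awalk_hd_in_verts)
  {
    assume "(c, m) \<in> cover.visited (u, k) p"
    then obtain i where i: "(c, m) = cover.state_at (u, k) p i"
      by (auto simp: cover.visited_def)
    have "cover.run (u, k) p (v, k + rotor N p)" using assms run_iff_awalk[OF u] by blast
    from cover.run_take[OF this, of i] have "cover.run (u, k) (take i p) (c, m)" by (simp add: i)
    then show "\<exists>p1 p2. p = p1 @ p2 \<and> G.awalk u p1 c \<and> m = k + rotor N p1"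
      using run_iff_awalk[OF u] by (metis append_take_drop_id)
  next
    assume "\<exists>p1 p2. p = p1 @ p2 \<and> G.awalk u p1 c \<and> m = k + rotor N p1"
    then obtain p1 p2 where p: "p = p1 @ p2" "G.awalk u p1 c" "m = k + rotor N p1" by blast
    then have "cover.run (u, k) p1 (c, m)" using run_iff_awalk[OF u] by blast
    then have "cover.state_at (u, k) p (length p1) = (c, m)"
      using cover.run_foldl p(1) by (auto simp: cover.state_at_def)
    then show "(c, m) \<in> cover.visited (u, k) p" using p(1)
      by (auto simp: cover.visited_def intro!: image_eqI[of _ _ "length p1"])
  }
qed

lemma run_inj:
  assumes "u \<in> verts (graph N)" "cover.run (u, k) p t"
  shows "inj_on (cover.state_at (u, k) p) {..length p}"
proof -
  have False if ij: "i < j" "j \<le> length p" "cover.state_at (u, k) p i = cover.state_at (u, k) p j" for i j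
  proof -
    obtain c m where cm: "cover.state_at (u, k) p i = (c, m)" by fastforce
    have "cover.run (u, k) (take i p) (c, m)" "cover.run (u, k) (take j p) (c, m)"
      using cover.run_take[OF assms(2), of i] cover.run_take[OF assms(2), of j] ij cm by auto
    then have w: "G.awalk u (take i p) c" "G.awalk u (take j p) c"
      using run_iff_awalk[OF assms(1)] by blast+
    have "take j p = take i p @ take (j - i) (drop i p)"
      using ij(1) by (metis less_imp_le_nat take_add le_add_diff_inverse)
    then have "G.awalk c (take (j - i) (drop i p)) c"
      using w awalk_rest by metis
    then show False using no_closed_walk[of c "take (j - i) (drop i p)"] ij by auto
  qed
  then show ?thesis by (metis atMost_iff inj_onI linorder_neqE_nat)
qed

lemma source_verts: "source N (residue_rep n i) \<in> verts (graph N)"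
  using source_vert residue_rep_bounds n_pos by blast

lemma ij_paths_run:
  "p \<in> ij_paths n N i j \<longleftrightarrow>
   cover.run (source N (residue_rep n i), alpha n i) p (sink N (residue_rep n j), alpha n j)"
  unfolding ij_paths_def using run_iff_awalk[OF source_verts] by (auto simp: awalk_apath)

lemma finite_ij_paths: "finite (ij_paths n N i j)"
  unfolding ij_paths_def by (rule finite_subset[OF _ G.apaths_finite]) auto

lemma awalk_prefix_iff:
  assumes "G.awalk u p v"
  shows "c \<in> set (G.awalk_verts u p) \<longleftrightarrow> (\<exists>p1 p2. p = p1 @ p2 \<and> G.awalk u p1 c \<and> G.awalk c p2 v)"
proof
  assume "\<exists>p1 p2. p = p1 @ p2 \<and> G.awalk u p1 c \<and> G.awalk c p2 v"
  then obtain p1 p2 where p: "p = p1 @ p2" "G.awalk u p1 c" "G.awalk c p2 v" by blast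
  then show "c \<in> set (G.awalk_verts u p)"
    using G.set_awalk_verts_append[OF p(2,3)] G.hd_in_awalk_verts(1)[OF p(3)] by simp
qed (rule G.awalk_decomp[OF assms])

text \<open>No edge of the first part leaves \<open>c\<close>, as it would start a closed walk.\<close>

lemma split_at_vertex:
  assumes "G.awalk u p1 c" "G.awalk c p2 v"
  shows "takeWhile (\<lambda>e. tail (graph N) e \<noteq> c) (p1 @ p2) = p1"
    "dropWhile (\<lambda>e. tail (graph N) e \<noteq> c) (p1 @ p2) = p2"
proof -
  have p1: "tail (graph N) e \<noteq> c" if "e \<in> set p1" for e
  proof
    assume e: "tail (graph N) e = c"
    obtain q1 q2 where q: "p1 = q1 @ e # q2" using \<open>e \<in> set p1\<close> by (meson split_list)
    then have "G.awalk (G.awlast u q1) (e # q2) c" using assms(1) by (metis G.awalk_append_iff)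
    moreover from this have "G.awlast u q1 = c" using e by (simp add: G.awalk_Cons_iff)
    ultimately show False using no_closed_walk by blast
  qed
  have p2: "p2 = [] \<or> tail (graph N) (hd p2) = c"
    using assms(2) by (cases p2) (auto simp: G.awalk_Cons_iff)
  show "takeWhile (\<lambda>e. tail (graph N) e \<noteq> c) (p1 @ p2) = p1"
    "dropWhile (\<lambda>e. tail (graph N) e \<noteq> c) (p1 @ p2) = p2"
    using p1 p2 by (auto simp: takeWhile_append2 dropWhile_append2 takeWhile_eq_Nil_iff dropWhile_eq_self_iff)
qed

lemma awalk_join: "G.awalk u p c \<Longrightarrow> G.awalk c q v \<Longrightarrow> G.awalk u (p @ q) v"
  by (rule G.awalk_appendI) auto

lemma rotor_append: "rotor N (p @ q) = rotor N p + rotor N q"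
  by (simp add: rotor_def)

text \<open>When \<open>p\<close> and \<open>q\<close> are cut at \<open>c\<close>, the switched path has the rotor required by \<open>i\<close> and \<open>j'\<close> if and only
if both lifts reach \<open>c\<close> at the same level.\<close>

lemma uncrossed_iff:
  assumes p: "p \<in> ij_paths n N i j" and q: "q \<in> ij_paths n N i' j'"
  shows "uncrossed n N i p i' j' q \<longleftrightarrow>
    cover.visited (source N (residue_rep n i), alpha n i) p \<inter>
    cover.visited (source N (residue_rep n i'), alpha n i') q = {}"
proof -
  let ?u = "source N (residue_rep n i)" and ?u' = "source N (residue_rep n i')"
  let ?v = "sink N (residue_rep n j)" and ?v' = "sink N (residue_rep n j')"
  have wp: "G.awalk ?u p ?v" and wq: "G.awalk ?u' q ?v'" and rq: "rotor N q = alpha n j' - alpha n i'"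
    using p q by (auto simp: ij_paths_def awalk_apath)
  have switch: "switch_at (graph N) c p q \<in> ij_paths n N i j' \<longleftrightarrow>
      alpha n i + rotor N p1 = alpha n i' + rotor N q1"
    if d: "p = p1 @ p2" "G.awalk ?u p1 c" "G.awalk c p2 ?v" "q = q1 @ q2" "G.awalk ?u' q1 c" "G.awalk c q2 ?v'"
    for c p1 p2 q1 q2
  proof -
    have "switch_at (graph N) c p q = p1 @ q2"
      unfolding switch_at_def d(1,4) split_at_vertex(1)[OF d(2,3)] split_at_vertex(2)[OF d(5,6)] ..
    then show ?thesis
      using awalk_join[OF d(2,6)] rq unfolding d(4) by (auto simp: ij_paths_def awalk_apath rotor_append)
  qed
  have "(\<exists>c. proper_crossing n N i p i' j' q c) \<longleftrightarrow>
    (\<exists>c m. (c, m) \<in> cover.visited (?u, alpha n i) p \<and> (c, m) \<in> cover.visited (?u', alpha n i') q)"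
  proof safe
    fix c assume pc: "proper_crossing n N i p i' j' q c"
    then have c: "c \<in> set (G.awalk_verts ?u p)" "c \<in> set (G.awalk_verts ?u' q)"
      and s: "switch_at (graph N) c p q \<in> ij_paths n N i j'"
      unfolding proper_crossing_def by blast+
    obtain p1 p2 where p12: "p = p1 @ p2" "G.awalk ?u p1 c" "G.awalk c p2 ?v"
      using G.awalk_decomp[OF wp c(1)] by blast
    obtain q1 q2 where q12: "q = q1 @ q2" "G.awalk ?u' q1 c" "G.awalk c q2 ?v'"
      using G.awalk_decomp[OF wq c(2)] by blast
    have "alpha n i + rotor N p1 = alpha n i' + rotor N q1"
      using s switch[OF p12 q12] by blast
    then have "(c, alpha n i + rotor N p1) \<in> cover.visited (?u, alpha n i) p"
      "(c, alpha n i + rotor N p1) \<in> cover.visited (?u', alpha n i') q"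
      unfolding visited_iff[OF wp] visited_iff[OF wq] using p12 q12 by blast+
    then show "\<exists>c m. (c, m) \<in> cover.visited (?u, alpha n i) p \<and> (c, m) \<in> cover.visited (?u', alpha n i') q"
      by blast
  next
    fix c m assume m: "(c, m) \<in> cover.visited (?u, alpha n i) p" "(c, m) \<in> cover.visited (?u', alpha n i') q"
    obtain p1 p2 where 1: "p = p1 @ p2" "G.awalk ?u p1 c" "m = alpha n i + rotor N p1"
      using m(1) unfolding visited_iff[OF wp] by blast
    obtain q1 q2 where 2: "q = q1 @ q2" "G.awalk ?u' q1 c" "m = alpha n i' + rotor N q1"
      using m(2) unfolding visited_iff[OF wq] by blast
    have d: "G.awalk c p2 ?v" "G.awalk c q2 ?v'"
      using awalk_rest[of ?u p1 p2 ?v c] awalk_rest[of ?u' q1 q2 ?v' c] wp wq 1 2 by blast+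
    have "switch_at (graph N) c p q \<in> ij_paths n N i j'"
      using switch[OF 1(1,2) d(1) 2(1,2) d(2)] 1(3) 2(3) by simp
    then have "proper_crossing n N i p i' j' q c"
      unfolding proper_crossing_def awalk_prefix_iff[OF wp] awalk_prefix_iff[OF wq]
      using 1(1,2) 2(1,2) d by (intro conjI exI) assumption+
    then show "\<exists>c. proper_crossing n N i p i' j' q c" ..
  qed
  then show ?thesis unfolding uncrossed_def by auto
qed

end

section \<open>Lifted paths cross at vertices\<close>

text \<open>A network with a lift \<open>h\<close> of its chord from \<open>(a, 0)\<close> to \<open>(b, 1)\<close> and with angles of the sources and
sinks in the windows of one turn that start at \<open>a\<close> and \<open>b\<close>. The lift of a source or sink of level \<open>k\<close>
is then found in the \<open>k\<close>-th translate of this window.\<close>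

locale lifted_network = cylindric_network n N + periodic_chord h a b
  for n :: nat and N :: "('v, 'e) cyl_network" and h :: "real \<Rightarrow> real \<times> real" and a b :: real +
  fixes \<theta> \<phi> :: "nat \<Rightarrow> real"
  assumes h_lift: "is_lift (chord N) h"
    and source_pos: "i \<in> {1..n} \<Longrightarrow> position N (source N i) = cyl_cover (\<theta> i, 0)"
    and source_mono: "strict_mono_on {1..n} \<theta>"
    and source_window: "i \<in> {1..n} \<Longrightarrow> a < \<theta> i" "i \<in> {1..n} \<Longrightarrow> \<theta> i < a + 2 * pi"
    and sink_pos: "i \<in> {1..n} \<Longrightarrow> position N (sink N i) = cyl_cover (\<phi> i, 1)"
    and sink_mono: "strict_mono_on {1..n} \<phi>"
    and sink_window: "i \<in> {1..n} \<Longrightarrow> b < \<phi> i" "i \<in> {1..n} \<Longrightarrow> \<phi> i < b + 2 * pi"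
begin

definition source_lift :: "int \<Rightarrow> real" where
  "source_lift i = \<theta> (residue_rep n i) + 2 * pi * of_int (alpha n i)"

definition sink_lift :: "int \<Rightarrow> real" where
  "sink_lift j = \<phi> (residue_rep n j) + 2 * pi * of_int (alpha n j)"

lemma window_less:
  assumes "alpha n i < alpha n i' \<or> alpha n i = alpha n i' \<and> residue_rep n i < residue_rep n i'"
    and mono: "strict_mono_on {1..n} \<psi>" and window: "\<And>i. i \<in> {1..n} \<Longrightarrow> c < \<psi> i \<and> \<psi> i < c + 2 * pi"
  shows "\<psi> (residue_rep n i) + 2 * pi * of_int (alpha n i) < \<psi> (residue_rep n i') + 2 * pi * of_int (alpha n i')"
proof -
  have r: "residue_rep n i \<in> {1..n}" "residue_rep n i' \<in> {1..n}"
    using residue_rep_bounds n_pos by blast+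
  from assms(1) show ?thesis
  proof
    assume "alpha n i < alpha n i'"
    then have "real_of_int (alpha n i) + 1 \<le> of_int (alpha n i')" by linarith
    from mult_left_mono[OF this, of "2 * pi"]
    have "2 * pi * of_int (alpha n i) + 2 * pi \<le> 2 * pi * of_int (alpha n i')" by (simp add: algebra_simps)
    then show ?thesis using window[OF r(1)] window[OF r(2)] by linarith
  next
    assume "alpha n i = alpha n i' \<and> residue_rep n i < residue_rep n i'"
    then show ?thesis using strict_mono_onD[OF mono r] by simp
  qed
qed

lemma source_lift_less: "i < i' \<Longrightarrow> source_lift i < source_lift i'"
  unfolding source_lift_def
  by (rule window_less[OF residue_alpha_less[OF n_pos] source_mono, of _ _ a]) (use source_window in auto)

lemma sink_lift_less: "j < j' \<Longrightarrow> sink_lift j < sink_lift j'"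
  unfolding sink_lift_def
  by (rule window_less[OF residue_alpha_less[OF n_pos] sink_mono, of _ _ b]) (use sink_window in auto)

lemma cyl_cover_source_lift: "cyl_cover (source_lift i, 0) = position N (source N (residue_rep n i))"
proof -
  have "residue_rep n i \<in> {1..n}" using residue_rep_bounds n_pos by blast
  moreover have "(source_lift i, 0) = shift (alpha n i) (\<theta> (residue_rep n i), 0)"
    by (simp add: shift_def source_lift_def)
  ultimately show ?thesis using source_pos by simp
qed

lemma level_source_lift: "level (source_lift i, 0) = alpha n i"
proof (rule level_bottom)
  have "residue_rep n i \<in> {1..n}" using residue_rep_bounds n_pos by blast
  then show "a + 2 * pi * of_int (alpha n i) < source_lift i"
    "source_lift i < a + 2 * pi * (of_int (alpha n i) + 1)"
    using source_window[of "residue_rep n i"] by (simp_all add: source_lift_def algebra_simps)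
qed

text \<open>The lifts of a sink differ by full turns and so have different levels.\<close>

lemma sink_lift_unique:
  assumes "cyl_cover y = position N (sink N (residue_rep n j))" "level y = alpha n j"
  shows "y = (sink_lift j, 1)"
proof -
  have r: "residue_rep n j \<in> {1..n}" using residue_rep_bounds n_pos by blast
  have "cyl_cover (\<phi> (residue_rep n j), 1) = cyl_cover y" using assms(1) sink_pos[OF r] by simp
  then obtain m where y: "y = shift m (\<phi> (residue_rep n j), 1)" by (auto simp: cyl_cover_eq_iff)
  have "level (\<phi> (residue_rep n j) + 2 * pi * of_int m, 1) = m"
    using sink_window[OF r] by (intro level_top) (simp_all add: algebra_simps)
  then have "m = alpha n j" using assms(2) y by (simp add: shift_def)
  then show ?thesis using y by (simp add: shift_def sink_lift_def)
qed

lemma edge_facts: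
  assumes "e \<in> arcs (graph N)"
  shows "arc (curve N e)" "path_image (curve N e) \<subseteq> cylinder"
    "curve N e 0 = position N (tail (graph N) e)" "curve N e 1 = position N (head (graph N) e)"
    "path_image (curve N e) \<inter> position N ` verts (graph N) =
       {position N (tail (graph N) e), position N (head (graph N) e)}"
  using embedded assms unfolding embedded_in_cylinder_def pathstart_def pathfinish_def by blast+

lemma edge_lift_level:
  assumes e: "e \<in> arcs (graph N)" and g: "is_lift (curve N e) g"
  shows "level (g 1) = level (g 0) + curve_rotor (chord N) (curve N e)"
proof (rule lift_level[OF h_lift g edge_facts(2)[OF e]])
  show "finite {t \<in> {0..1}. curve N e t \<in> path_image (chord N)}"
    by (rule chord_meets_finitely[OF e])
qed (use e edge_facts[OF e] chord_avoids_verts in auto)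

text \<open>The point \<open>z\<close> lies on the lift \<open>g\<close> of the edge \<open>e\<close> of \<open>p\<close>, where \<open>p\<close> is lifted starting at level \<open>k\<close>; the
lift is pinned down by the level of its start, which the rotor of \<open>p1\<close> determines.\<close>

definition on_lifted_edge :: "int \<Rightarrow> 'e list \<Rightarrow> real \<times> real \<Rightarrow> 'e list \<Rightarrow> 'e \<Rightarrow> 'e list \<Rightarrow> (real \<Rightarrow> real \<times> real) \<Rightarrow> bool" where
  "on_lifted_edge k p z p1 e p2 g \<longleftrightarrow>
     p = p1 @ e # p2 \<and> is_lift (curve N e) g \<and> z \<in> path_image g \<and> level (g 0) = k + rotor N p1"

lemma walk_lift:
  assumes "G.awalk u p v" "p \<noteq> []" "cyl_cover x = position N u"
  shows "\<exists>\<gamma>. path \<gamma> \<and> path_image \<gamma> \<subseteq> strip \<and> pathstart \<gamma> = x \<and>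
    cyl_cover (pathfinish \<gamma>) = position N v \<and> level (pathfinish \<gamma>) = level x + rotor N p \<and>
    (\<forall>z\<in>path_image \<gamma>. \<exists>p1 e p2 g. on_lifted_edge (level x) p z p1 e p2 g)"
  using assms
proof (induction p arbitrary: u x)
  case (Cons e p)
  have e: "e \<in> arcs (graph N)" "tail (graph N) e = u" and p: "G.awalk (head (graph N) e) p v"
    using Cons.prems(1) by (auto simp: G.awalk_Cons_iff)
  obtain g where g: "is_lift (curve N e) g" "g 0 = x"
    using lift_exists[of "curve N e" x] edge_facts[OF e(1)] Cons.prems(3) e(2)
    by (metis arc_imp_path)
  have path_g: "path g" and strip_g: "path_image g \<subseteq> strip"
    using g(1) lift_in_strip[OF g(1) edge_facts(2)[OF e(1)]] by (auto simp: is_lift_def)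
  have end_g: "cyl_cover (g 1) = position N (head (graph N) e)"
    using g(1) edge_facts(4)[OF e(1)] by (simp add: is_lift_def)
  have level_g: "level (g 1) = level x + curve_rotor (chord N) (curve N e)"
    using edge_lift_level[OF e(1) g(1)] g(2) by simp
  have "on_lifted_edge (level x) (e # p) z [] e p g" if "z \<in> path_image g" for z
    using that g by (simp add: on_lifted_edge_def rotor_def)
  then have on_g: "\<forall>z\<in>path_image g. \<exists>p1 e' p2 g'. on_lifted_edge (level x) (e # p) z p1 e' p2 g'"
    by blast
  show ?case
  proof (cases "p = []")
    case True
    then have "v = head (graph N) e" using p by (simp add: G.awalk_Nil_iff)
    then show ?thesis
      using path_g strip_g end_g level_g on_g g(2) True
      by (intro exI[of _ g] conjI) (simp_all add: pathstart_def pathfinish_def rotor_def)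
  next
    case False
    obtain \<gamma> where \<gamma>: "path \<gamma>" "path_image \<gamma> \<subseteq> strip" "pathstart \<gamma> = g 1"
      "cyl_cover (pathfinish \<gamma>) = position N v" "level (pathfinish \<gamma>) = level (g 1) + rotor N p"
      "\<And>z. z \<in> path_image \<gamma> \<Longrightarrow> \<exists>p1 e p2 g'. on_lifted_edge (level (g 1)) p z p1 e p2 g'"
      using Cons.IH[OF p False end_g] by blast
    have on_\<gamma>: "\<exists>p1 e' p2 g'. on_lifted_edge (level x) (e # p) z p1 e' p2 g'" if z: "z \<in> path_image \<gamma>" for z
    proof -
      obtain p1 e' p2 g' where "on_lifted_edge (level (g 1)) p z p1 e' p2 g'" using \<gamma>(6)[OF z] by blast
      then have "on_lifted_edge (level x) (e # p) z (e # p1) e' p2 g'"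
        using level_g by (simp add: on_lifted_edge_def rotor_def)
      then show ?thesis by blast
    qed
    have join: "pathfinish g = pathstart \<gamma>" using \<gamma>(3) by (simp add: pathfinish_def)
    have im: "path_image (g +++ \<gamma>) = path_image g \<union> path_image \<gamma>"
      by (rule path_image_join[OF join])
    have "level (pathfinish (g +++ \<gamma>)) = level x + rotor N (e # p)"
      using \<gamma>(5) level_g by (simp add: rotor_def)
    moreover have "pathstart (g +++ \<gamma>) = x" using g(2) by (simp add: pathstart_def[of g])
    moreover have "\<forall>z\<in>path_image (g +++ \<gamma>). \<exists>p1 e' p2 g'. on_lifted_edge (level x) (e # p) z p1 e' p2 g'"
      unfolding im using on_g on_\<gamma> by blast
    ultimately show ?thesis
      using path_g \<gamma>(1,2,4) join strip_g im by (intro exI[of _ "g +++ \<gamma>"]) simp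
  qed
qed simp

text \<open>The curve of \<open>e\<close> contains no vertices but its two ends, so \<open>c\<close> is reached by \<open>p\<close> before or after \<open>e\<close>.\<close>

lemma lifted_edge_vertex:
  assumes p: "G.awalk u p v" and z: "on_lifted_edge k p z p1 e p2 g"
    and c: "c \<in> verts (graph N)" "cyl_cover z = position N c"
  shows "\<exists>q1 q2. p = q1 @ q2 \<and> G.awalk u q1 c \<and> level z = k + rotor N q1"
proof -
  have d: "p = p1 @ e # p2" "is_lift (curve N e) g" "z \<in> path_image g" "level (g 0) = k + rotor N p1"
    using z by (auto simp: on_lifted_edge_def)
  have w: "G.awalk u p1 (tail (graph N) e)" and e: "e \<in> arcs (graph N)"
    using p unfolding d(1) by (auto simp: G.awalk_Cons_iff)
  then have w': "G.awalk u (p1 @ [e]) (head (graph N) e)"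
    by (intro awalk_join) (auto intro: G.arc_implies_awalk)
  obtain t where t: "t \<in> {0..1}" "z = g t" using d(3) by (auto simp: path_image_def)
  have ct: "curve N e t = position N c" using d(2) t c(2) by (simp add: is_lift_def)
  have inj: "inj_on (curve N e) {0..1}" using edge_facts(1)[OF e] by (simp add: arc_def)
  have "position N c \<in> path_image (curve N e) \<inter> position N ` verts (graph N)"
    using ct t(1) c(1) by (metis IntI imageI path_image_def)
  then have "position N c \<in> {position N (tail (graph N) e), position N (head (graph N) e)}"
    using edge_facts(5)[OF e] by blast
  moreover have inj_pos: "inj_on (position N) (verts (graph N))"
    using embedded by (simp add: embedded_in_cylinder_def)
  ultimately have "c = tail (graph N) e \<or> c = head (graph N) e"
    using c(1) e by (auto simp: inj_on_eq_iff[OF inj_pos])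
  then show ?thesis
  proof
    assume "c = tail (graph N) e"
    then have "t = 0" using ct edge_facts(3)[OF e] inj_onD[OF inj, of t 0] t(1) by simp
    then show ?thesis using d w t \<open>c = tail (graph N) e\<close> by blast
  next
    assume h: "c = head (graph N) e"
    then have "t = 1" using ct edge_facts(4)[OF e] inj_onD[OF inj, of t 1] t(1) by simp
    then have "level z = k + rotor N (p1 @ [e])"
      using d(4) t(2) edge_lift_level[OF e d(2)] by (simp add: rotor_def)
    moreover have "p = (p1 @ [e]) @ p2" using d(1) by simp
    ultimately show ?thesis using w' h by blast
  qed
qed

text \<open>Curves of different edges only meet in vertices. If both lifts belong to the same edge, then they pass
\<open>z\<close> at the same time, as the curve is an arc, so they coincide and the walks share the start of the edge.\<close>

lemma lifted_walks_meet_at_vertex: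
  assumes p: "G.awalk u p v" and q: "G.awalk u' q v'"
    and z: "on_lifted_edge k p z p1 e p2 g" "on_lifted_edge k' q z q1 f q2 g'"
  shows "cover.visited (u, k) p \<inter> cover.visited (u', k') q \<noteq> {}"
proof -
  have dp: "p = p1 @ e # p2" "is_lift (curve N e) g" "z \<in> path_image g" "level (g 0) = k + rotor N p1"
    and dq: "q = q1 @ f # q2" "is_lift (curve N f) g'" "z \<in> path_image g'" "level (g' 0) = k' + rotor N q1"
    using z by (auto simp: on_lifted_edge_def)
  have wp: "G.awalk u p1 (tail (graph N) e)" and e: "e \<in> arcs (graph N)"
    using p unfolding dp(1) by (auto simp: G.awalk_Cons_iff)
  have wq: "G.awalk u' q1 (tail (graph N) f)" and f: "f \<in> arcs (graph N)"
    using q unfolding dq(1) by (auto simp: G.awalk_Cons_iff)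
  obtain s where s: "s \<in> {0..1}" "z = g s" using dp(3) by (auto simp: path_image_def)
  obtain t where t: "t \<in> {0..1}" "z = g' t" using dq(3) by (auto simp: path_image_def)
  have cs: "curve N e s = cyl_cover z" and ct: "curve N f t = cyl_cover z"
    using dp(2) dq(2) s t unfolding is_lift_def by metis+
  show ?thesis
  proof (cases "e = f")
    case True
    have "s = t"
      using cs ct s(1) t(1) True inj_onD[of "curve N e" "{0..1}" s t] edge_facts(1)[OF e] by (simp add: arc_def)
    obtain m where m: "\<And>r. r \<in> {0..1} \<Longrightarrow> g' r = shift m (g r)"
      using lift_unique[OF dp(2)] dq(2) True by metis
    have "m = 0" using m[OF s(1)] s(2) t(2) \<open>s = t\<close> by (auto simp: shift_def prod_eq_iff)
    then have "g' 0 = g 0" using m[of 0] by simp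
    then have "(tail (graph N) e, level (g 0)) \<in> cover.visited (u, k) p"
      "(tail (graph N) e, level (g 0)) \<in> cover.visited (u', k') q"
      unfolding visited_iff[OF p] visited_iff[OF q] using dp(1,4) dq(1,4) wp wq True by auto
    then show ?thesis by blast
  next
    case False
    have "cyl_cover z \<in> path_image (curve N e) \<inter> path_image (curve N f)"
      using cs ct s(1) t(1) by (metis IntI imageI path_image_def)
    moreover have "path_image (curve N e) \<inter> path_image (curve N f) \<subseteq> position N ` verts (graph N)"
      using embedded e f False unfolding embedded_in_cylinder_def by blast
    ultimately obtain c where c: "c \<in> verts (graph N)" "cyl_cover z = position N c" by blast
    have "(c, level z) \<in> cover.visited (u, k) p" "(c, level z) \<in> cover.visited (u', k') q"
      unfolding visited_iff[OF p] visited_iff[OF q]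
      using lifted_edge_vertex[OF p z(1) c] lifted_edge_vertex[OF q z(2) c] by blast+
    then show ?thesis by blast
  qed
qed

lemma path_strip_lift:
  assumes p: "p \<in> ij_paths n N i j"
  obtains \<gamma> where "path \<gamma>" "path_image \<gamma> \<subseteq> strip" "pathstart \<gamma> = (source_lift i, 0)"
    "pathfinish \<gamma> = (sink_lift j, 1)"
    "\<And>z. z \<in> path_image \<gamma> \<Longrightarrow> \<exists>p1 e p2 g. on_lifted_edge (alpha n i) p z p1 e p2 g"
proof -
  let ?u = "source N (residue_rep n i)" and ?v = "sink N (residue_rep n j)"
  have w: "G.awalk ?u p ?v" and r: "rotor N p = alpha n j - alpha n i"
    using p by (auto simp: ij_paths_def awalk_apath)
  have "p \<noteq> []"
  proof
    assume "p = []"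
    then have "?u = ?v" using w by (simp add: G.awalk_Nil_iff)
    moreover have "residue_rep n i \<in> {1..n}" "residue_rep n j \<in> {1..n}"
      using residue_rep_bounds n_pos by blast+
    ultimately show False using source_bottom sink_top by fastforce
  qed
  from walk_lift[OF w this cyl_cover_source_lift] obtain \<gamma> where \<gamma>: "path \<gamma>" "path_image \<gamma> \<subseteq> strip"
    "pathstart \<gamma> = (source_lift i, 0)" "cyl_cover (pathfinish \<gamma>) = position N ?v"
    "level (pathfinish \<gamma>) = alpha n j"
    "\<And>z. z \<in> path_image \<gamma> \<Longrightarrow> \<exists>p1 e p2 g. on_lifted_edge (alpha n i) p z p1 e p2 g"
    using r unfolding level_source_lift by auto
  from that[OF \<gamma>(1-3) sink_lift_unique[OF \<gamma>(4,5)] \<gamma>(6)] show thesis .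
qed

text \<open>The level keeps lifted sources and sinks in the order of their indices, so the lifted curves have
their ends on the two boundary lines of the strip in opposite order.\<close>

lemma crossing_paths_meet:
  assumes "i < i'" "j < j'" and p: "p \<in> ij_paths n N i j'" and q: "q \<in> ij_paths n N i' j"
  shows "cover.visited (source N (residue_rep n i), alpha n i) p \<inter>
    cover.visited (source N (residue_rep n i'), alpha n i') q \<noteq> {}"
proof -
  obtain \<gamma> where \<gamma>: "path \<gamma>" "path_image \<gamma> \<subseteq> strip" "pathstart \<gamma> = (source_lift i, 0)"
    "pathfinish \<gamma> = (sink_lift j', 1)"
    "\<And>z. z \<in> path_image \<gamma> \<Longrightarrow> \<exists>p1 e p2 g. on_lifted_edge (alpha n i) p z p1 e p2 g"
    using path_strip_lift[OF p] by metis
  obtain \<delta> where \<delta>: "path \<delta>" "path_image \<delta> \<subseteq> strip" "pathstart \<delta> = (source_lift i', 0)"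
    "pathfinish \<delta> = (sink_lift j, 1)"
    "\<And>z. z \<in> path_image \<delta> \<Longrightarrow> \<exists>q1 f q2 g. on_lifted_edge (alpha n i') q z q1 f q2 g"
    using path_strip_lift[OF q] by metis
  have "path_image \<gamma> \<inter> path_image \<delta> \<noteq> {}"
    by (rule strip_paths_cross[OF \<gamma>(1-4) \<delta>(1-4) source_lift_less[OF assms(1)] sink_lift_less[OF assms(2)]])
  then obtain z where z: "z \<in> path_image \<gamma>" "z \<in> path_image \<delta>" by blast
  have w: "G.awalk (source N (residue_rep n i)) p (sink N (residue_rep n j'))"
    "G.awalk (source N (residue_rep n i')) q (sink N (residue_rep n j))"
    using p q by (auto simp: ij_paths_def awalk_apath)
  show ?thesis
    using \<gamma>(5)[OF z(1)] \<delta>(5)[OF z(2)] lifted_walks_meet_at_vertex[OF w] by blast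
qed

end

lemma (in cylindric_network) ex_lifted_network: "\<exists>h a b \<theta> \<phi>. lifted_network n N h a b \<theta> \<phi>"
proof -
  have path_chord: "path (chord N)" using chord_arc(1) by (rule arc_imp_path)
  have "chord N 0 \<in> cylinder" using chord_arc(2) by (auto simp: path_image_def)
  then have "norm (fst (chord N 0)) = 1" by (auto simp: cylinder_def mem_Times_iff)
  moreover from this have "fst (chord N 0) \<noteq> 0" by auto
  ultimately have "cis (Arg (fst (chord N 0))) = fst (chord N 0)"
    by (simp add: cis_Arg sgn_div_norm)
  then obtain h where h: "is_lift (chord N) h"
    using lift_exists[OF path_chord chord_arc(2), of "(Arg (fst (chord N 0)), snd (chord N 0))"]
    by (metis cyl_cover_def fst_conv snd_conv prod.collapse)
  define a b where "a = fst (h 0)" and "b = fst (h 1)"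
  have hc: "cyl_cover (h t) = chord N t" if "t \<in> {0..1}" for t using h that by (simp add: is_lift_def)
  have snd_h: "snd (h t) = snd (chord N t)" if "t \<in> {0..1}" for t
    using hc[OF that] by (metis cyl_cover_def snd_conv)
  have cis_h: "cis (fst (h t)) = fst (chord N t)" if "t \<in> {0..1}" for t
    using hc[OF that] by (metis cyl_cover_def fst_conv)
  have inj: "inj_on (chord N) {0..1}" using chord_arc(1) by (simp add: arc_def)
  have "periodic_chord h a b"
  proof
    have "inj_on h {0..1}"
      by (rule inj_onI) (metis hc inj inj_onD)
    then show "arc h" using h by (simp add: arc_def is_lift_def)
    show "pathstart h = (a, 0)" "pathfinish h = (b, 1)"
      using snd_h[of 0] snd_h[of 1] chord_start(1) chord_finish(1)
      by (simp_all add: pathstart_def pathfinish_def a_def b_def prod_eq_iff)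
    show "snd (h t) \<in> {0<..<1}" if "t \<in> {0<..<1}" for t
      using chord_interior[OF that] snd_h[of t] that by auto
    fix x k assume "x \<in> path_image h" "shift k x \<in> path_image h"
    then obtain s t where st: "s \<in> {0..1}" "x = h s" "t \<in> {0..1}" "shift k x = h t"
      by (auto simp: path_image_def)
    then have "chord N s = chord N t" by (metis hc cyl_cover_shift)
    then have "s = t" using inj_onD[OF inj, of s t] st by simp
    then show "k = 0" using st by (auto simp: shift_def prod_eq_iff)
  qed
  have bottom: "cis a \<in> ccw_arc (fst (position N (source N n))) (fst (position N (source N 1)))"
    using chord_start(2) cis_h[of 0] by (simp add: a_def pathstart_def)
  have top: "cis b \<in> ccw_arc (fst (position N (sink N n))) (fst (position N (sink N 1)))"
    using chord_finish(2) cis_h[of 1] by (simp add: b_def pathfinish_def)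
  obtain \<theta> where \<theta>: "\<And>i. i \<in> {1..n} \<Longrightarrow> fst (position N (source N i)) = cis (\<theta> i)"
    "strict_mono_on {1..n} \<theta>" "\<And>i. i \<in> {1..n} \<Longrightarrow> a < \<theta> i" "\<And>i. i \<in> {1..n} \<Longrightarrow> \<theta> i < a + 2 * pi"
    using ccw_window[OF source_ccw n_pos bottom] by metis
  obtain \<phi> where \<phi>: "\<And>i. i \<in> {1..n} \<Longrightarrow> fst (position N (sink N i)) = cis (\<phi> i)"
    "strict_mono_on {1..n} \<phi>" "\<And>i. i \<in> {1..n} \<Longrightarrow> b < \<phi> i" "\<And>i. i \<in> {1..n} \<Longrightarrow> \<phi> i < b + 2 * pi"
    using ccw_window[OF sink_ccw n_pos top] by metis
  have "lifted_network n N h a b \<theta> \<phi>"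
  proof (intro lifted_network.intro lifted_network_axioms.intro)
    show "position N (source N i) = cyl_cover (\<theta> i, 0)" if "i \<in> {1..n}" for i
      using \<theta>(1)[OF that] source_bottom[OF that] by (simp add: cyl_cover_def prod_eq_iff)
    show "position N (sink N i) = cyl_cover (\<phi> i, 1)" if "i \<in> {1..n}" for i
      using \<phi>(1)[OF that] sink_top[OF that] by (simp add: cyl_cover_def prod_eq_iff)
  qed (use cylindric_network_axioms \<open>periodic_chord h a b\<close> h \<theta> \<phi> in auto)
  then show ?thesis by blast
qed

section \<open>Minors of the network matrix\<close>

theorem theorem3p2:
  fixes n :: nat and N :: "('v, 'e) cyl_network" and I J :: "int set"
  assumes "cylindric_network n N"
    and "finite I" and "finite J" and "card I = card J"
  shows "int_minor I J (network_matrix n N) =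
    (\<Sum>P\<in>uncrossed_families n N I J. family_weight N (card I) P)"
proof -
  interpret cylindric_network n N by (rule assms(1))
  obtain h a b \<theta> \<phi> where "lifted_network n N h a b \<theta> \<phi>" using ex_lifted_network by blast
  then interpret L: lifted_network n N h a b \<theta> \<phi> .
  define K where "K = card I"
  define i where "i = (!) (sorted_list_of_set I)"
  define j where "j = (!) (sorted_list_of_set J)"
  define A where "A k = (source N (residue_rep n (i k)), alpha n (i k))" for k
  define B where "B k = (sink N (residue_rep n (j k)), alpha n (j k))" for k
  have i_less: "i k < i l" if "k < l" "l < K" for k l
    using that assms(2) sorted_wrt_nth_less[OF strict_sorted_list_of_set[of I]] by (simp add: i_def K_def)
  have j_less: "j k < j l" if "k < l" "l < K" for k l
    using that assms(3,4) sorted_wrt_nth_less[OF strict_sorted_list_of_set[of J]] by (simp add: j_def K_def)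
  have run: "cover.run (A k) p (B l) \<longleftrightarrow> p \<in> ij_paths n N (i k) (j l)" for k l p
    by (simp add: ij_paths_run A_def B_def)
  \<comment> \<open>Acyclicity of the network makes all paths of the lifted graph simple.\<close>
  interpret F: path_families "cover_enabled N" "cover_step N" K A B
  proof
    show "finite {p. cover.run (A k) p (B l)}" for k l
      unfolding run using finite_ij_paths by simp
    show "inj_on (cover.state_at (A k) p) {..length p}" if "cover.run (A k) p (B l)" for k l p
      using run_inj[OF source_verts] that unfolding A_def by blast
  qed
  have uncrossed: "uncrossed n N (i k) (P k) (i l) (j l) (P l) \<longleftrightarrow>
      cover.visited (A k) (P k) \<inter> cover.visited (A l) (P l) = {}"
    if "P \<in> F.families id" "k < K" "l < K" for P k l
  proof -
    have "P k \<in> ij_paths n N (i k) (j k)" "P l \<in> ij_paths n N (i l) (j l)"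
      using that unfolding F.families_def by (auto simp flip: run)
    then show ?thesis unfolding A_def by (rule uncrossed_iff)
  qed
  have "uncrossed_families n N I J = {P \<in> F.families id.
      \<forall>k<K. \<forall>l<K. k \<noteq> l \<longrightarrow> uncrossed n N (i k) (P k) (i l) (j l) (P l)}"
    unfolding uncrossed_families_def Let_def F.families_def
      i_def[symmetric] j_def[symmetric] K_def[symmetric] run by simp
  also have "\<dots> = {P \<in> F.families id. F.disjoint_runs P}"
    unfolding F.disjoint_runs_def using uncrossed by (intro Collect_cong conj_cong) auto
  finally have families: "uncrossed_families n N I J = {P \<in> F.families id. F.disjoint_runs P}" .
  have "int_minor I J (network_matrix n N) =
    Determinant.det (Matrix.mat K K (\<lambda>(k, l). \<Sum>p | cover.run (A k) p (B l). \<Prod>e\<leftarrow>p. edge_weight N e))"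
    unfolding int_minor_def assms(4)[symmetric] K_def[symmetric] i_def[symmetric] j_def[symmetric]
      run network_matrix_def path_weight_def by simp
  also have "\<dots> = (\<Sum>P | P \<in> F.families id \<and> F.disjoint_runs P. \<Prod>k<K. \<Prod>e\<leftarrow>P k. edge_weight N e)"
  proof (rule F.lindstroem_gessel_viennot_planar)
    fix k k' l l' p q
    assume less: "k < k'" "k' < K" "l < l'" "l' < K"
      and runs: "cover.run (A k) p (B l')" "cover.run (A k') q (B l)"
    show "cover.visited (A k) p \<inter> cover.visited (A k') q \<noteq> {}"
      unfolding A_def
      by (rule L.crossing_paths_meet[OF i_less[OF less(1,2)] j_less[OF less(3,4)] runs[unfolded run]])
  qed
  also have "\<dots> = (\<Sum>P\<in>uncrossed_families n N I J. family_weight N (card I) P)"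
    unfolding families family_weight_def path_weight_def K_def[symmetric] ..
  finally show ?thesis .
qed

end
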